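(* Consider a protocol for postselected metrology with arbitrary state preparation and arbitrary projective postselection: an initial quantum state $\hat\rho_0$ on a Hilbert space $\mathcal{H}$ evolves to $\hat\rho_\theta=\hat U(\theta)\hat\rho_0\hat U(\theta)^\dagger$ with $\hat U(\theta)=e^{-i\hat A\theta}$, where $\hat A$ is an observable (Hermitian operator) and $\theta\in\mathbb{R}$ is the parameter to be estimated; then $\hat\rho_\theta$ is postselected with a projector $\hat F=\sum_{f\in\mathcal{F}^{ps}}|f\rangle\langle f|$. Let $p_\theta^{ps}=\mathrm{Tr}(\hat F\hat\rho_\theta)$ be the total probability of successful postselection, let $\mathcal{I}_Q$ be the postselected quantum Fisher information, and let $\xi^{ps}(p_\theta^{ps};\mathcal{I}_Q)=p_\theta^{ps}\,\mathcal{I}_Q$ be the efficiency of the protocol. Then $$0\le \xi^{ps}(p_\theta^{ps};\mathcal{I}_Q)\le 4\,\|\hat A^2\|_{\mathrm{op}} .$$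
   Context: The set $\mathcal{F}^{ps}$ is a chosen subset of an orthonormal basis of $\mathcal{H}$ (the postselection basis). The postselected quantum Fisher information $\mathcal{I}_Q$ is the quantum Fisher information about $\theta$ (the Fisher information optimized over measurements) carried by the renormalized state that passes the postselection, $\hat F\hat\rho_\theta\hat F/p_\theta^{ps}$. When $\hat\rho_\theta=|\psi_\theta\rangle\langle\psi_\theta|$ is pure it is given by $$\mathcal{I}_Q(\theta|\psi_\theta^{ps})=\frac{4}{p_\theta^{ps}}\langle\dot\Psi_\theta^{ps}|\dot\Psi_\theta^{ps}\rangle-\frac{4}{(p_\theta^{ps})^2}\left|\langle\dot\Psi_\theta^{ps}|\Psi_\theta^{ps}\rangle\right|^2,$$ where $|\Psi_\theta^{ps}\rangle=\hat F|\psi_\theta\rangle$ and $|\dot\Psi_\theta^{ps}\rangle=\partial_\theta|\Psi_\theta^{ps}\rangle$. The operator norm is $\|\hat X\|_{\mathrm{op}}=\sup\{\langle\phi|\hat X|\phi\rangle:\ |\phi\rangle\in\mathcal{H},\ \langle\phi|\phi\rangle=1\}$. *)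

theory Defs
  imports "HOL-Analysis.Analysis"
begin

section \<open>Complex Hilbert spaces\<close>

text \<open>The inner product is antilinear in the first and linear in the second argument
  (bra-ket convention). Real scaling and the norm are those of the library class
  \<^class>\<open>real_normed_vector\<close>, tied to the complex structure by the axioms.\<close>

class complex_inner = real_normed_vector +
  fixes scaleC :: "complex \<Rightarrow> 'a \<Rightarrow> 'a"  (infixr "*\<^sub>C" 75)
    and cinner :: "'a \<Rightarrow> 'a \<Rightarrow> complex"
  assumes scaleC_add_right: "a *\<^sub>C (x + y) = a *\<^sub>C x + a *\<^sub>C y"
    and scaleC_add_left: "(a + b) *\<^sub>C x = a *\<^sub>C x + b *\<^sub>C x"
    and scaleC_scaleC: "a *\<^sub>C b *\<^sub>C x = (a * b) *\<^sub>C x"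
    and scaleC_one: "1 *\<^sub>C x = x"
    and scaleR_scaleC: "r *\<^sub>R x = complex_of_real r *\<^sub>C x"
    and cinner_commute: "cinner x y = cnj (cinner y x)"
    and cinner_add_right: "cinner x (y + z) = cinner x y + cinner x z"
    and cinner_scaleC_right: "cinner x (a *\<^sub>C y) = a * cinner x y"
    and cinner_ge_zero: "0 \<le> Re (cinner x x)"
    and cinner_eq_zero_iff: "cinner x x = 0 \<longleftrightarrow> x = 0"
    and norm_eq_sqrt_cinner: "norm x = sqrt (Re (cinner x x))"

class chilbert_space = complex_inner + complete_space

instantiation complex :: chilbert_space
begin

definition scaleC_complex :: "complex \<Rightarrow> complex \<Rightarrow> complex"
  where "scaleC_complex a x = a * x"

definition cinner_complex :: "complex \<Rightarrow> complex \<Rightarrow> complex"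
  where "cinner_complex x y = cnj x * y"

instance
  by intro_classes
    (auto simp: scaleC_complex_def cinner_complex_def algebra_simps scaleR_conv_of_real
      norm_complex_def power2_eq_square)

end

text \<open>The standard \<open>n\<close>-dimensional space \<open>complex ^ 'n\<close> is an instance.\<close>

instantiation vec :: (chilbert_space, finite) chilbert_space
begin

definition scaleC_vec :: "complex \<Rightarrow> 'a ^ 'b \<Rightarrow> 'a ^ 'b"
  where "scaleC_vec a x = (\<chi> i. a *\<^sub>C (x $ i))"

definition cinner_vec :: "'a ^ 'b \<Rightarrow> 'a ^ 'b \<Rightarrow> complex"
  where "cinner_vec x y = (\<Sum>i\<in>UNIV. cinner (x $ i) (y $ i))"

instance
proof
  fix a b :: complex and r :: real and x y z :: "'a ^ 'b"
  show "a *\<^sub>C (x + y) = a *\<^sub>C x + a *\<^sub>C y"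
    by (simp add: scaleC_vec_def vec_eq_iff scaleC_add_right)
  show "(a + b) *\<^sub>C x = a *\<^sub>C x + b *\<^sub>C x"
    by (simp add: scaleC_vec_def vec_eq_iff scaleC_add_left)
  show "a *\<^sub>C b *\<^sub>C x = (a * b) *\<^sub>C x"
    by (simp add: scaleC_vec_def vec_eq_iff scaleC_scaleC)
  show "1 *\<^sub>C x = x"
    by (simp add: scaleC_vec_def vec_eq_iff scaleC_one)
  show "r *\<^sub>R x = complex_of_real r *\<^sub>C x"
    by (simp add: scaleC_vec_def vec_eq_iff scaleR_scaleC)
  show "cinner x y = cnj (cinner y x)"
    unfolding cinner_vec_def cnj_sum by (intro sum.cong refl cinner_commute)
  show "cinner x (y + z) = cinner x y + cinner x z"
    by (simp add: cinner_vec_def cinner_add_right sum.distrib)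
  show "cinner x (a *\<^sub>C y) = a * cinner x y"
    by (simp add: cinner_vec_def scaleC_vec_def cinner_scaleC_right sum_distrib_left)
  show ge: "0 \<le> Re (cinner x x)"
    by (simp add: cinner_vec_def sum_nonneg cinner_ge_zero)
  have sq: "Re (cinner u u) = (norm u)\<^sup>2" for u :: 'a
    by (simp add: norm_eq_sqrt_cinner cinner_ge_zero)
  show nrm: "norm x = sqrt (Re (cinner x x))"
    by (simp add: cinner_vec_def norm_vec_def L2_set_def sq)
  show "cinner x x = 0 \<longleftrightarrow> x = 0"
  proof
    assume "cinner x x = 0"
    with nrm show "x = 0"
      by (metis norm_eq_zero real_sqrt_zero zero_complex.sel(1))
  next
    assume "x = 0"
    then show "cinner x x = 0"
      by (simp add: cinner_vec_def cinner_eq_zero_iff)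
  qed
qed

end

section \<open>Operators, orthonormal bases, trace\<close>

definition bounded_clinear :: "('a::complex_inner \<Rightarrow> 'a) \<Rightarrow> bool"
  where "bounded_clinear X \<longleftrightarrow> bounded_linear X \<and> (\<forall>c x. X (c *\<^sub>C x) = c *\<^sub>C X x)"

text \<open>Boundedness of an everywhere defined symmetric operator is automatic
  (Hellinger--Toeplitz).\<close>

definition hermitian_op :: "('a::complex_inner \<Rightarrow> 'a) \<Rightarrow> bool"
  where "hermitian_op X \<longleftrightarrow> bounded_clinear X \<and> (\<forall>x y. cinner (X x) y = cinner x (X y))"

definition positive_op :: "('a::complex_inner \<Rightarrow> 'a) \<Rightarrow> bool"
  where "positive_op X \<longleftrightarrow>
    bounded_clinear X \<and> (\<forall>x. Im (cinner x (X x)) = 0 \<and> 0 \<le> Re (cinner x (X x)))"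

definition cadjoint :: "('a::complex_inner \<Rightarrow> 'a) \<Rightarrow> ('a \<Rightarrow> 'a)"
  where "cadjoint X = (SOME Y. \<forall>x y. cinner (Y x) y = cinner x (X y))"

definition orthonormal_basis :: "'a::complex_inner set \<Rightarrow> bool"
  where "orthonormal_basis B \<longleftrightarrow>
    (\<forall>b\<in>B. \<forall>c\<in>B. cinner b c = (if b = c then 1 else 0)) \<and>
    closure (module.span scaleC B) = UNIV"

text \<open>For trace-class operators the value does not depend on the basis chosen.\<close>

definition trace_op :: "('a::complex_inner \<Rightarrow> 'a) \<Rightarrow> complex"
  where "trace_op X = (\<Sum>\<^sub>\<infinity>b\<in>(SOME B. orthonormal_basis B). cinner b (X b))"

text \<open>A diverging trace gets the value \<open>0\<close>, so trace \<open>1\<close> entails that the positive operator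
  is trace class.\<close>

definition density_op :: "('a::complex_inner \<Rightarrow> 'a) \<Rightarrow> bool"
  where "density_op \<rho> \<longleftrightarrow> positive_op \<rho> \<and> trace_op \<rho> = 1"

text \<open>The supremum of expectation values over unit vectors; used only for the positive
  bounded operator \<open>A\<^sup>2\<close>, for which it coincides with the usual operator norm.\<close>

definition op_norm :: "('a::complex_inner \<Rightarrow> 'a) \<Rightarrow> real"
  where "op_norm X = (SUP \<phi>\<in>{\<phi>. cinner \<phi> \<phi> = 1}. Re (cinner \<phi> (X \<phi>)))"

section \<open>Fisher information\<close>

text \<open>Measurements are POVMs with countably many outcomes; finitely many outcomes are the
  case in which all but finitely many effects vanish.\<close>

definition povm :: "(nat \<Rightarrow> 'a::complex_inner \<Rightarrow> 'a) \<Rightarrow> bool"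
  where "povm M \<longleftrightarrow> (\<forall>k. positive_op (M k)) \<and> (\<forall>x. (\<lambda>k. M k x) sums x)"

text \<open>Fisher information about the parameter of the distribution \<open>p t\<close> on outcomes \<open>k\<close>;
  as usual, only outcomes of positive probability contribute.\<close>

definition fisher_information :: "(real \<Rightarrow> nat \<Rightarrow> real) \<Rightarrow> real \<Rightarrow> ereal"
  where "fisher_information p \<theta> =
    (\<Sum>k. if p \<theta> k > 0 then ereal ((deriv (\<lambda>t. p t k) \<theta>)\<^sup>2 / p \<theta> k) else 0)"

definition quantum_fisher_information ::
    "(real \<Rightarrow> 'a::complex_inner \<Rightarrow> 'a) \<Rightarrow> real \<Rightarrow> ereal"
  where "quantum_fisher_information \<sigma> \<theta> =
    (SUP M\<in>{M. povm M}. fisher_information (\<lambda>t k. Re (trace_op (M k \<circ> \<sigma> t))) \<theta>)"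

section \<open>Postselected metrology\<close>

text \<open>\<open>exp (- \<i> A \<theta>)\<close> as a power series.\<close>

definition evolution :: "('a::complex_inner \<Rightarrow> 'a) \<Rightarrow> real \<Rightarrow> 'a \<Rightarrow> 'a"
  where "evolution A \<theta> x =
    (\<Sum>n. ((- \<i> * complex_of_real \<theta>) ^ n / fact n) *\<^sub>C (A ^^ n) x)"

definition evolved_state :: "('a::complex_inner \<Rightarrow> 'a) \<Rightarrow> ('a \<Rightarrow> 'a) \<Rightarrow> real \<Rightarrow> 'a \<Rightarrow> 'a"
  where "evolved_state A \<rho>\<^sub>0 \<theta> = evolution A \<theta> \<circ> \<rho>\<^sub>0 \<circ> cadjoint (evolution A \<theta>)"

definition ps_projector :: "'a::complex_inner set \<Rightarrow> 'a \<Rightarrow> 'a"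
  where "ps_projector Fps x = (\<Sum>\<^sub>\<infinity>f\<in>Fps. cinner f x *\<^sub>C f)"

definition ps_probability ::
    "('a::complex_inner \<Rightarrow> 'a) \<Rightarrow> ('a \<Rightarrow> 'a) \<Rightarrow> 'a set \<Rightarrow> real \<Rightarrow> real"
  where "ps_probability A \<rho>\<^sub>0 Fps \<theta> = Re (trace_op (ps_projector Fps \<circ> evolved_state A \<rho>\<^sub>0 \<theta>))"

text \<open>Meaningful only if the probability is positive; at probability \<open>0\<close> the efficiency
  below is \<open>0\<close>, by \<open>0 * x = 0\<close> in the extended reals.\<close>

definition ps_state ::
    "('a::complex_inner \<Rightarrow> 'a) \<Rightarrow> ('a \<Rightarrow> 'a) \<Rightarrow> 'a set \<Rightarrow> real \<Rightarrow> 'a \<Rightarrow> 'a"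
  where "ps_state A \<rho>\<^sub>0 Fps \<theta> x =
    (1 / ps_probability A \<rho>\<^sub>0 Fps \<theta>) *\<^sub>R
      (ps_projector Fps \<circ> evolved_state A \<rho>\<^sub>0 \<theta> \<circ> ps_projector Fps) x"

definition ps_qfi ::
    "('a::complex_inner \<Rightarrow> 'a) \<Rightarrow> ('a \<Rightarrow> 'a) \<Rightarrow> 'a set \<Rightarrow> real \<Rightarrow> ereal"
  where "ps_qfi A \<rho>\<^sub>0 Fps \<theta> = quantum_fisher_information (ps_state A \<rho>\<^sub>0 Fps) \<theta>"

definition ps_efficiency :: "real \<Rightarrow> ereal \<Rightarrow> ereal"
  where "ps_efficiency p I = ereal p * I"

end

theory Submission
  imports Defs
begin

text \<open>Cholesky elimination along an orthonormal basis writes the initial state as a countable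
  mixture of pure states \<open>|u n><u n|\<close>, so that with \<open>w n = exp (- \<i> A \<theta>) (u n)\<close> every outcome of a
  measurement \<open>M\<close> after postselection has probability \<open>q k / P\<close>, where
  \<open>q k = (\<Sum>n. <w n|F (M k) F|w n>)\<close> and \<open>P = (\<Sum>n. <w n|F|w n>)\<close>. Cauchy--Schwarz for the positive
  form of \<open>F (M k) F\<close>, applied to \<open>w n\<close> and \<open>a n = - \<i> A (w n) - (P' / 2 P) w n\<close>, bounds the
  contribution of outcome \<open>k\<close> to the Fisher information by
  \<open>4 / P\<close> times \<open>\<Sum>n. <a n|F (M k) F|a n>\<close>. The effects sum to the identity, so the total is at most
  \<open>4 / P\<close> times \<open>(\<Sum>n. <a n|F|a n>) = (\<Sum>n. <A (w n)|F|A (w n)>) - P'\<^sup>2 / (4 P)\<close>, and the first term is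
  at most the norm of \<open>A\<^sup>2\<close>.\<close>

section \<open>Inner product and positive operators\<close>

instance chilbert_space \<subseteq> banach ..

lemma complex_inner_module: "module (scaleC :: complex \<Rightarrow> 'a::complex_inner \<Rightarrow> 'a)"
  by unfold_locales (simp_all add: scaleC_add_right scaleC_add_left scaleC_scaleC scaleC_one)

lemma cinner_add_left: "cinner (x + y) z = cinner x z + cinner y z"
  by (metis cinner_add_right cinner_commute complex_cnj_add)

lemma cinner_scaleC_left: "cinner (a *\<^sub>C x) y = cnj a * cinner x y"
  by (metis cinner_scaleC_right cinner_commute complex_cnj_mult)

lemma cinner_scaleR_right: "cinner x (r *\<^sub>R y) = of_real r * cinner x y"
  by (simp add: scaleR_scaleC cinner_scaleC_right)

lemma cinner_scaleR_left: "cinner (r *\<^sub>R x) y = of_real r * cinner x y"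
  by (simp add: scaleR_scaleC cinner_scaleC_left)

lemma cinner_zero_right [simp]: "cinner x 0 = 0"
  using cinner_add_right[of x 0 0] by simp

lemma cinner_zero_left [simp]: "cinner 0 x = 0"
  using cinner_add_left[of 0 0 x] by simp

lemma cinner_minus_right: "cinner x (- y) = - cinner x y"
  using cinner_add_right[of x y "- y"] by (simp add: eq_neg_iff_add_eq_0 add.commute)

lemma cinner_minus_left: "cinner (- x) y = - cinner x y"
  using cinner_add_left[of x "- x" y] by (simp add: eq_neg_iff_add_eq_0 add.commute)

lemma cinner_diff_right: "cinner x (y - z) = cinner x y - cinner x z"
  using cinner_add_right[of x y "- z"] by (simp add: cinner_minus_right)

lemma cinner_diff_left: "cinner (x - y) z = cinner x z - cinner y z"
  using cinner_add_left[of x "- y" z] by (simp add: cinner_minus_left)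

lemmas cinner_simps =
  cinner_add_left cinner_add_right cinner_diff_left cinner_diff_right
  cinner_minus_left cinner_minus_right cinner_scaleC_left cinner_scaleC_right
  cinner_scaleR_left cinner_scaleR_right

lemma cinner_sum_right: "cinner x (sum f S) = (\<Sum>i\<in>S. cinner x (f i))"
  by (induction S rule: infinite_finite_induct) (simp_all add: cinner_add_right)

lemma cinner_sum_left: "cinner (sum f S) x = (\<Sum>i\<in>S. cinner (f i) x)"
  by (induction S rule: infinite_finite_induct) (simp_all add: cinner_add_left)

lemma cinner_self: "cinner x x = of_real ((norm x)\<^sup>2)"
proof (rule complex_eqI)
  show "Re (cinner x x) = Re (of_real ((norm x)\<^sup>2))"
    by (simp add: norm_eq_sqrt_cinner cinner_ge_zero)
  have "cinner x x = cnj (cinner x x)"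
    by (rule cinner_commute)
  then show "Im (cinner x x) = Im (of_real ((norm x)\<^sup>2))"
    by (metis Im_complex_of_real complex_cnj_cancel_iff complex_In_mult_cnj_zero cnj.sel(2)
        neg_equal_zero)
qed

lemma norm_square_cinner: "(norm x)\<^sup>2 = Re (cinner x x)"
  by (simp add: cinner_self)

lemma cinner_ext:
  assumes "\<And>z. cinner z x = cinner z y"
  shows "x = y"
proof -
  have "cinner (x - y) (x - y) = 0"
    using assms by (simp add: cinner_diff_right)
  then show ?thesis
    by (simp add: cinner_eq_zero_iff)
qed

section \<open>Linear operators and positive quadratic forms\<close>

lemma bounded_clinear_add: "bounded_clinear X \<Longrightarrow> X (x + y) = X x + X y"
  and bounded_clinear_scaleC: "bounded_clinear X \<Longrightarrow> X (c *\<^sub>C x) = c *\<^sub>C X x"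
  and bounded_clinear_diff: "bounded_clinear X \<Longrightarrow> X (x - y) = X x - X y"
  and bounded_clinear_scaleR: "bounded_clinear X \<Longrightarrow> X (r *\<^sub>R x) = r *\<^sub>R X x"
  by (simp_all add: bounded_clinear_def bounded_linear.linear linear_add linear_diff
      linear_scale)

lemma positive_opD:
  assumes "positive_op X"
  shows "bounded_clinear X" "Im (cinner x (X x)) = 0" "0 \<le> Re (cinner x (X x))"
  using assms by (auto simp: positive_op_def)

text \<open>Polarization: the form is real at \<open>x + y\<close>, which makes the imaginary parts
  of \<open>cinner x (X y)\<close> and \<open>cinner y (X x)\<close> cancel. Replacing
  \<open>y\<close> by i times \<open>y\<close> turns this into equality of their real parts.\<close>

lemma positive_op_hermitian:
  assumes X: "positive_op X"
  shows "cinner (X x) y = cinner x (X y)"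
proof -
  note lin = bounded_clinear_add[OF positive_opD(1)[OF X]]
    bounded_clinear_scaleC[OF positive_opD(1)[OF X]]
  have 1: "Im (cinner x (X y) + cinner y (X x)) = 0" for x y
    using positive_opD(2)[OF X, of "x + y"] positive_opD(2)[OF X, of x]
      positive_opD(2)[OF X, of y]
    by (simp add: lin cinner_simps)
  have 2: "Re (cinner x (X y) - cinner y (X x)) = 0" for x y
    using 1[of x "\<i> *\<^sub>C y"] by (simp add: lin cinner_simps)
  have "cinner x (X y) = cnj (cinner y (X x))"
    using 1[of x y] 2[of x y] by (simp add: complex_eq_iff)
  then show ?thesis
    by (metis cinner_commute)
qed

lemma positive_op_self:
  assumes "positive_op X"
  shows "cinner x (X x) = of_real (Re (cinner x (X x)))"
  using positive_opD(2)[OF assms, of x] by (simp add: complex_eq_iff)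

text \<open>The form is nonnegative at \<open>x - s * cnj \<beta> * y\<close> for real
  \<open>s\<close>. The factor \<open>cnj \<beta>\<close> aligns the phases, so that both cross
  terms equal -s|\<beta>|^2 and a real quadratic polynomial in \<open>s\<close> remains.\<close>

lemma positive_op_Cauchy_Schwarz:
  assumes X: "positive_op X"
  shows "(cmod (cinner x (X y)))\<^sup>2 \<le> Re (cinner x (X x)) * Re (cinner y (X y))"
proof -
  note lin = bounded_clinear_add[OF positive_opD(1)[OF X]]
    bounded_clinear_scaleC[OF positive_opD(1)[OF X]]
    bounded_clinear_diff[OF positive_opD(1)[OF X]]
  define a where "a = Re (cinner x (X x))"
  define d where "d = Re (cinner y (X y))"
  define \<beta> where "\<beta> = cinner x (X y)"
  define b where "b = (cmod \<beta>)\<^sup>2"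
  have d0: "0 \<le> d"
    using positive_opD(3)[OF X] by (simp add: d_def)
  have \<beta>': "cinner y (X x) = cnj \<beta>"
    unfolding \<beta>_def by (metis positive_op_hermitian[OF X] cinner_commute)
  have \<beta>\<beta>: "cnj \<beta> * \<beta> = of_real b" "\<beta> * cnj \<beta> = of_real b"
    unfolding b_def by (metis complex_norm_square mult.commute)+
  have key: "0 \<le> a - 2 * s * b + s\<^sup>2 * b * d" for s :: real
  proof -
    have "0 \<le> Re (cinner (x - (of_real s * cnj \<beta>) *\<^sub>C y) (X (x - (of_real s * cnj \<beta>) *\<^sub>C y)))"
      by (rule positive_opD(3)[OF X])
    also have "cinner (x - (of_real s * cnj \<beta>) *\<^sub>C y) (X (x - (of_real s * cnj \<beta>) *\<^sub>C y)) =
      of_real a - of_real s * (cnj \<beta> * \<beta>) - of_real s * (\<beta> * cnj \<beta>) +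
      of_real (s\<^sup>2) * (\<beta> * cnj \<beta>) * of_real d"
      using positive_op_self[OF X, of x] positive_op_self[OF X, of y]
      unfolding lin cinner_simps \<beta>_def[symmetric] \<beta>' a_def d_def
      by (simp add: algebra_simps power2_eq_square)
    also have "\<dots> = of_real (a - 2 * s * b + s\<^sup>2 * b * d)"
      unfolding \<beta>\<beta> by simp
    finally show ?thesis
      by simp
  qed
  have "b \<le> a * d"
  proof (cases "d = 0")
    case True
    have "b = 0"
    proof (rule ccontr)
      assume "b \<noteq> 0"
      \<comment> \<open>For \<open>d = 0\<close> the polynomial is affine in \<open>s\<close>, and
        this value of \<open>s\<close> makes it equal to -1.\<close>
      then show False
        using key[of "(a + 1) / (2 * b)"] True by simp
    qed
    then show ?thesis
      using True by simp
  next
    case False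
    \<comment> \<open>The value s = 1/d minimizes the polynomial.\<close>
    have "0 \<le> a - 2 * (1 / d) * b + (1 / d)\<^sup>2 * b * d"
      by (rule key)
    also have "\<dots> = a - b / d"
      using False by (simp add: field_simps power2_eq_square)
    finally show ?thesis
      using False d0 by (simp add: field_simps)
  qed
  then show ?thesis
    by (simp add: a_def b_def d_def \<beta>_def)
qed

lemma positive_op_id: "positive_op (\<lambda>x. x)"
  by (simp add: positive_op_def bounded_clinear_def cinner_self)

lemma cinner_Cauchy_Schwarz: "cmod (cinner x y) \<le> norm x * norm y"
proof (rule power2_le_imp_le)
  show "(cmod (cinner x y))\<^sup>2 \<le> (norm x * norm y)\<^sup>2"
    using positive_op_Cauchy_Schwarz[OF positive_op_id, of x y]
    by (simp only: norm_square_cinner[symmetric] power_mult_distrib)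
qed simp

lemma bounded_bilinear_cinner: "bounded_bilinear cinner"
proof
  show "\<exists>K. \<forall>a b. norm (cinner a b) \<le> norm a * norm b * K"
    by (intro exI[of _ 1]) (simp add: cinner_Cauchy_Schwarz)
qed (simp_all add: cinner_simps scaleR_conv_of_real)

lemma norm_scaleC: "norm (c *\<^sub>C x) = cmod c * norm x"
proof -
  have "(norm (c *\<^sub>C x))\<^sup>2 = (cmod c * norm x)\<^sup>2"
  proof -
    have "complex_of_real ((norm (c *\<^sub>C x))\<^sup>2) = of_real ((cmod c * norm x)\<^sup>2)"
      unfolding cinner_self[symmetric] cinner_simps
      using complex_norm_square[of c] by (simp add: cinner_self power_mult_distrib mult_ac)
    then show ?thesis
      using of_real_eq_iff by blast
  qed
  then show ?thesis
    by (simp add: power2_eq_iff_nonneg)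
qed

section \<open>Orthonormal bases and the postselection projector\<close>

text \<open>Complete the square in each coefficient. Only the last sum depends on \<open>r\<close>,
  and it vanishes for r b = <b|x>, so the Fourier coefficients give the best approximation from the
  span of \<open>S\<close>.\<close>

lemma orthonormal_residual:
  assumes orth: "\<And>b c. b \<in> S \<Longrightarrow> c \<in> S \<Longrightarrow> cinner b c = (if b = c then 1 else 0)"
    and fin: "finite S"
  shows "(norm (x - (\<Sum>b\<in>S. r b *\<^sub>C b)))\<^sup>2 =
    (norm x)\<^sup>2 - (\<Sum>b\<in>S. (cmod (cinner b x))\<^sup>2) + (\<Sum>b\<in>S. (cmod (r b - cinner b x))\<^sup>2)"
proof -
  have "cinner (\<Sum>b\<in>S. r b *\<^sub>C b) (\<Sum>b\<in>S. r b *\<^sub>C b) =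
    (\<Sum>b\<in>S. \<Sum>c\<in>S. cnj (r b) * (r c * (if b = c then 1 else 0)))"
    unfolding cinner_sum_left cinner_sum_right cinner_simps sum_distrib_left
    by (rule sum.swap[THEN trans]) (simp add: orth mult_ac eq_commute cong: if_cong sum.cong)
  also have "\<dots> = (\<Sum>b\<in>S. cnj (r b) * r b)"
    using fin by (intro sum.cong refl) (simp add: if_distrib sum.delta cong: if_cong)
  finally have rr: "cinner (\<Sum>b\<in>S. r b *\<^sub>C b) (\<Sum>b\<in>S. r b *\<^sub>C b) = (\<Sum>b\<in>S. cnj (r b) * r b)" .
  have xr: "cinner x (\<Sum>b\<in>S. r b *\<^sub>C b) = (\<Sum>b\<in>S. r b * cnj (cinner b x))"
    by (simp add: cinner_sum_right cinner_simps cinner_commute[of x])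
  have rx: "cinner (\<Sum>b\<in>S. r b *\<^sub>C b) x = (\<Sum>b\<in>S. cnj (r b) * cinner b x)"
    by (simp add: cinner_sum_left cinner_simps)
  have "complex_of_real ((norm (x - (\<Sum>b\<in>S. r b *\<^sub>C b)))\<^sup>2) =
    of_real ((norm x)\<^sup>2) + (\<Sum>b\<in>S. cnj (r b) * r b - r b * cnj (cinner b x) - cnj (r b) * cinner b x)"
    unfolding cinner_self[symmetric] cinner_diff_left cinner_diff_right rr xr rx
    by (simp add: sum_subtractf cinner_self)
  also have "(\<Sum>b\<in>S. cnj (r b) * r b - r b * cnj (cinner b x) - cnj (r b) * cinner b x) =
     (\<Sum>b\<in>S. of_real ((cmod (r b - cinner b x))\<^sup>2) - of_real ((cmod (cinner b x))\<^sup>2))"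
    unfolding complex_norm_square by (intro sum.cong refl) (simp add: algebra_simps)
  finally have "complex_of_real ((norm (x - (\<Sum>b\<in>S. r b *\<^sub>C b)))\<^sup>2) = of_real ((norm x)\<^sup>2 +
     ((\<Sum>b\<in>S. (cmod (r b - cinner b x))\<^sup>2) - (\<Sum>b\<in>S. (cmod (cinner b x))\<^sup>2)))"
    by (simp add: sum_subtractf)
  then have "(norm (x - (\<Sum>b\<in>S. r b *\<^sub>C b)))\<^sup>2 = (norm x)\<^sup>2 +
     ((\<Sum>b\<in>S. (cmod (r b - cinner b x))\<^sup>2) - (\<Sum>b\<in>S. (cmod (cinner b x))\<^sup>2))"
    using of_real_eq_iff by blast
  then show ?thesis
    by simp
qed

section \<open>Expansion and Parseval identities\<close>

lemma orthonormal_basisD: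
  assumes "orthonormal_basis E" "b \<in> E" "c \<in> E"
  shows "cinner b c = (if b = c then 1 else 0)"
  using assms by (auto simp: orthonormal_basis_def)

text \<open>Density of the span gives a finite combination \<open>y\<close> within \<open>e\<close>
  of \<open>x\<close>. Over every finite \<open>S\<close> containing the support of
  \<open>y\<close>, the Fourier partial sum is at least as close to \<open>x\<close> as
  \<open>y\<close> is, by best approximation.\<close>

lemma orthonormal_expansion:
  assumes E: "orthonormal_basis E"
  shows "((\<lambda>b. cinner b x *\<^sub>C b) has_sum x) E"
  unfolding has_sum_def tendsto_iff
proof (intro allI impI)
  fix e :: real
  assume "0 < e"
  have "x \<in> closure (module.span scaleC E)"
    using E by (auto simp: orthonormal_basis_def)
  then obtain y where y: "y \<in> module.span scaleC E" "dist y x < e"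
    using \<open>0 < e\<close> by (auto simp: closure_approachable)
  obtain T r where T: "finite T" "T \<subseteq> E" and yT: "y = (\<Sum>b\<in>T. r b *\<^sub>C b)"
    using y(1) unfolding module.span_explicit[OF complex_inner_module] by blast
  have "dist (\<Sum>b\<in>S. cinner b x *\<^sub>C b) x < e" if S: "finite S" "S \<subseteq> E" "T \<subseteq> S" for S
  proof -
    define r' where "r' b = (if b \<in> T then r b else 0)" for b
    have yS: "y = (\<Sum>b\<in>S. r' b *\<^sub>C b)"
      unfolding yT
      by (rule sum.mono_neutral_cong_left)
         (use S in \<open>auto simp: r'_def module.scale_zero_left[OF complex_inner_module]\<close>)
    have orth: "cinner b c = (if b = c then 1 else 0)" if "b \<in> S" "c \<in> S" for b c
      using orthonormal_basisD[OF E] S that by blast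
    have residual: "(norm (x - (\<Sum>b\<in>S. r b *\<^sub>C b)))\<^sup>2 = (norm x)\<^sup>2 -
        (\<Sum>b\<in>S. (cmod (cinner b x))\<^sup>2) + (\<Sum>b\<in>S. (cmod (r b - cinner b x))\<^sup>2)" for r
      using orth S(1) by (rule orthonormal_residual)
    have "(norm (x - (\<Sum>b\<in>S. cinner b x *\<^sub>C b)))\<^sup>2 \<le> (norm (x - y))\<^sup>2"
      unfolding yS by (simp only: residual) (simp add: sum_nonneg)
    then have "norm (x - (\<Sum>b\<in>S. cinner b x *\<^sub>C b)) \<le> norm (x - y)"
      by (rule power2_le_imp_le) simp
    then show ?thesis
      using y(2) by (simp add: dist_norm norm_minus_commute)
  qed
  then show "\<forall>\<^sub>F S in finite_subsets_at_top E. dist (\<Sum>b\<in>S. cinner b x *\<^sub>C b) x < e"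
    using T unfolding eventually_finite_subsets_at_top by blast
qed

lemma parseval:
  assumes E: "orthonormal_basis E"
  shows "((\<lambda>b. cinner y b * cinner b x) has_sum cinner y x) E"
  using has_sum_bounded_linear[OF bounded_bilinear.bounded_linear_right[OF bounded_bilinear_cinner]
      orthonormal_expansion[OF E], of y x]
  by (simp add: cinner_scaleC_right mult.commute)

lemma parseval_norm:
  assumes E: "orthonormal_basis E"
  shows "((\<lambda>b. (cmod (cinner b x))\<^sup>2) has_sum (norm x)\<^sup>2) E"
proof -
  have "((\<lambda>b. Re (cinner x b * cinner b x)) has_sum Re (cinner x x)) E"
    by (intro has_sum_Re parseval E)
  moreover have "Re (cinner x b * cinner b x) = (cmod (cinner b x))\<^sup>2" for b
    by (metis Re_complex_of_real cinner_commute complex_norm_square mult.commute)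
  ultimately show ?thesis
    by (simp add: norm_square_cinner)
qed

text \<open>A subfamily of a summable family in a complete space is summable, so the infinite sum in
  \<open>ps_projector\<close> is a genuine limit and not the default value 0.\<close>

lemma ps_projector_has_sum:
  fixes B :: "'a::chilbert_space set"
  assumes "orthonormal_basis B" "Fps \<subseteq> B"
  shows "((\<lambda>f. cinner f x *\<^sub>C f) has_sum ps_projector Fps x) Fps"
  unfolding ps_projector_def
  using orthonormal_expansion[OF assms(1)] assms(2)
  by (intro has_sum_infsum) (meson has_sum_imp_summable summable_on_subset_banach)

lemma ps_projector_cinner:
  fixes B :: "'a::chilbert_space set"
  assumes "orthonormal_basis B" "Fps \<subseteq> B"
  shows "((\<lambda>f. cinner x f * cinner f y) has_sum cinner x (ps_projector Fps y)) Fps"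
  using has_sum_bounded_linear[OF bounded_bilinear.bounded_linear_right[OF bounded_bilinear_cinner]
    ps_projector_has_sum[OF assms], of x y]
  by (simp add: cinner_scaleC_right mult.commute)

lemma ps_projector_hermitian:
  fixes B :: "'a::chilbert_space set"
  assumes B: "orthonormal_basis B" "Fps \<subseteq> B"
  shows "cinner (ps_projector Fps x) y = cinner x (ps_projector Fps y)"
proof -
  have "((\<lambda>f. cnj (cinner y f * cinner f x)) has_sum cnj (cinner y (ps_projector Fps x))) Fps"
    using ps_projector_cinner[OF B, of y x] by (simp only: has_sum_cnj_iff)
  moreover have "cnj (cinner y f * cinner f x) = cinner x f * cinner f y" for f
    by (metis cinner_commute complex_cnj_mult mult.commute)
  ultimately have "((\<lambda>f. cinner x f * cinner f y) has_sum cinner (ps_projector Fps x) y) Fps"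
    by (simp add: cinner_commute[of "ps_projector Fps x"])
  then show ?thesis
    using ps_projector_cinner[OF B] has_sum_unique by blast
qed

lemma ps_projector_inner:
  fixes B :: "'a::chilbert_space set"
  assumes B: "orthonormal_basis B" "Fps \<subseteq> B" and f: "f \<in> Fps"
  shows "cinner f (ps_projector Fps x) = cinner f x"
proof -
  have "cinner f g * cinner g x = (if f = g then cinner f x else 0)" if "g \<in> Fps" for g
    using orthonormal_basisD[OF B(1), of f g] subsetD[OF B(2)] f that by auto
  moreover have "((\<lambda>g. if f = g then cinner f x else 0) has_sum cinner f x) Fps"
    using f by (intro has_sum_finite_neutralI[of "{f}"]) auto
  ultimately have "((\<lambda>g. cinner f g * cinner g x) has_sum cinner f x) Fps"
    by (simp cong: has_sum_cong)
  then show ?thesis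
    using ps_projector_cinner[OF B] has_sum_unique by blast
qed

text \<open>\<open>x\<close> and its projection have the same coefficients along \<open>Fps\<close>,
  and the projection depends only on these.\<close>

lemma ps_projector_idem:
  fixes B :: "'a::chilbert_space set"
  assumes B: "orthonormal_basis B" "Fps \<subseteq> B"
  shows "ps_projector Fps (ps_projector Fps x) = ps_projector Fps x"
proof -
  have "(\<Sum>\<^sub>\<infinity>f\<in>Fps. cinner f (ps_projector Fps x) *\<^sub>C f) = (\<Sum>\<^sub>\<infinity>f\<in>Fps. cinner f x *\<^sub>C f)"
    by (intro infsum_cong) (simp add: ps_projector_inner[OF B])
  then show ?thesis
    by (simp add: ps_projector_def[symmetric])
qed

lemma ps_projector_norm_square:
  fixes B :: "'a::chilbert_space set"
  assumes B: "orthonormal_basis B" "Fps \<subseteq> B"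
  shows "cinner x (ps_projector Fps x) = of_real ((norm (ps_projector Fps x))\<^sup>2)"
  by (metis cinner_self ps_projector_hermitian[OF B] ps_projector_idem[OF B])

lemma ps_projector_norm_le:
  fixes B :: "'a::chilbert_space set"
  assumes B: "orthonormal_basis B" "Fps \<subseteq> B"
  shows "norm (ps_projector Fps x) \<le> norm x"
proof -
  have "(norm (ps_projector Fps x))\<^sup>2 \<le> norm x * norm (ps_projector Fps x)"
    using cinner_Cauchy_Schwarz[of x "ps_projector Fps x"]
    by (simp add: ps_projector_norm_square[OF B] norm_power)
  then show ?thesis
    by (cases "ps_projector Fps x = 0") (auto simp: power2_eq_square)
qed

lemma ps_projector_positive:
  fixes B :: "'a::chilbert_space set"
  assumes B: "orthonormal_basis B" "Fps \<subseteq> B"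
  shows "positive_op (ps_projector Fps)"
proof -
  let ?F = "ps_projector Fps"
  note herm = ps_projector_hermitian[OF B, symmetric]
  have add: "?F (x + y) = ?F x + ?F y" for x y
    by (rule cinner_ext) (simp add: herm cinner_add_right)
  have scaleC: "?F (c *\<^sub>C x) = c *\<^sub>C ?F x" for c x
    by (rule cinner_ext) (simp add: herm cinner_scaleC_right)
  have "bounded_linear ?F"
    by (rule bounded_linear_intro[where K = 1])
       (simp_all add: add scaleC scaleR_scaleC ps_projector_norm_le[OF B])
  then show ?thesis
    by (simp add: positive_op_def bounded_clinear_def scaleC ps_projector_norm_square[OF B])
qed

section \<open>Mixtures of pure states\<close>

text \<open>The rank one correction makes the result vanish at \<open>e\<close>. If \<open><e|X e> = 0\<close>, then \<open>X\<close> is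
  unchanged because \<open>x / 0 = 0\<close>.\<close>

definition cholesky_step :: "'a::complex_inner \<Rightarrow> ('a \<Rightarrow> 'a) \<Rightarrow> 'a \<Rightarrow> 'a"
  where "cholesky_step e X x = X x - (cinner (X e) x / of_real (Re (cinner e (X e)))) *\<^sub>C X e"

lemma cinner_cholesky_step:
  "cinner y (cholesky_step e X x) =
    cinner y (X x) - cinner y (X e) * cinner (X e) x / of_real (Re (cinner e (X e)))"
  by (simp add: cholesky_step_def cinner_simps)

lemma bounded_clinear_cholesky_step:
  assumes X: "bounded_clinear X"
  shows "bounded_clinear (cholesky_step e X)"
proof -
  let ?d = "complex_of_real (Re (cinner e (X e)))"
  have "bounded_linear (\<lambda>x. (cinner (X e) x / ?d) *\<^sub>C X e)"
  proof (rule bounded_linear_intro[where K = "norm (X e) * norm (X e) / cmod ?d"])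
    fix x y :: 'a and r :: real
    show "(cinner (X e) (x + y) / ?d) *\<^sub>C X e =
        (cinner (X e) x / ?d) *\<^sub>C X e + (cinner (X e) y / ?d) *\<^sub>C X e"
      by (simp add: cinner_simps add_divide_distrib scaleC_add_left)
    show "(cinner (X e) (r *\<^sub>R x) / ?d) *\<^sub>C X e = r *\<^sub>R (cinner (X e) x / ?d) *\<^sub>C X e"
      by (simp add: cinner_simps scaleR_scaleC scaleC_scaleC)
    have "norm ((cinner (X e) x / ?d) *\<^sub>C X e) = cmod (cinner (X e) x) * (norm (X e) / cmod ?d)"
      by (simp add: norm_scaleC norm_divide)
    also have "\<dots> \<le> (norm (X e) * norm x) * (norm (X e) / cmod ?d)"
      by (intro mult_right_mono cinner_Cauchy_Schwarz) simp
    finally show "norm ((cinner (X e) x / ?d) *\<^sub>C X e) \<le>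
        norm x * (norm (X e) * norm (X e) / cmod ?d)"
      by (simp add: mult_ac)
  qed
  then have "bounded_linear (\<lambda>x. X x - (cinner (X e) x / ?d) *\<^sub>C X e)"
    using X unfolding bounded_clinear_def by (intro bounded_linear_sub) auto
  moreover have "cholesky_step e X (c *\<^sub>C x) = c *\<^sub>C cholesky_step e X x" for c x
    unfolding cholesky_step_def bounded_clinear_scaleC[OF X]
    by (simp add: cinner_simps module.scale_right_diff_distrib[OF complex_inner_module] scaleC_scaleC)
  ultimately show ?thesis
    by (simp add: bounded_clinear_def cholesky_step_def[abs_def])
qed

lemma cholesky_step_quadratic:
  assumes "positive_op X"
  shows "cinner x (cholesky_step e X x) =
    of_real (Re (cinner x (X x)) - (cmod (cinner x (X e)))\<^sup>2 / Re (cinner e (X e)))"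
proof -
  have "cinner x (X e) * cinner (X e) x = of_real ((cmod (cinner x (X e)))\<^sup>2)"
    by (metis cinner_commute complex_norm_square)
  then show ?thesis
    using positive_op_self[OF assms, of x] by (simp add: cinner_cholesky_step)
qed

text \<open>Positivity of the corrected form is exactly Cauchy--Schwarz for \<open>X\<close> at
  \<open>x\<close> and \<open>e\<close>. At a zero pivot nothing is subtracted.\<close>

lemma positive_op_cholesky_step:
  assumes X: "positive_op X"
  shows "positive_op (cholesky_step e X)"
proof -
  have "(cmod (cinner x (X e)))\<^sup>2 / Re (cinner e (X e)) \<le> Re (cinner x (X x))" for x
    using positive_op_Cauchy_Schwarz[OF X, of x e] positive_opD(3)[OF X]
    by (cases "Re (cinner e (X e)) = 0") (auto simp: divide_le_eq less_le)
  then show ?thesis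
    using positive_opD(1)[OF X] unfolding positive_op_def
    by (auto simp: cholesky_step_quadratic[OF X] bounded_clinear_cholesky_step)
qed

section \<open>Iterated elimination\<close>

primrec cholesky :: "(nat \<Rightarrow> 'a::complex_inner) \<Rightarrow> ('a \<Rightarrow> 'a) \<Rightarrow> nat \<Rightarrow> 'a \<Rightarrow> 'a"
  where
    "cholesky e X 0 = X"
  | "cholesky e X (Suc n) = cholesky_step (e n) (cholesky e X n)"

text \<open>Scaled so that |u><u| is the rank one term removed at step \<open>n\<close>. A zero
  pivot yields the zero vector because 1 / 0 = 0.\<close>

definition cholesky_vec :: "(nat \<Rightarrow> 'a::complex_inner) \<Rightarrow> ('a \<Rightarrow> 'a) \<Rightarrow> nat \<Rightarrow> 'a"
  where "cholesky_vec e X n =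
    (1 / sqrt (Re (cinner (e n) (cholesky e X n (e n))))) *\<^sub>R cholesky e X n (e n)"

lemma positive_op_cholesky: "positive_op X \<Longrightarrow> positive_op (cholesky e X n)"
  by (induction n) (simp_all add: positive_op_cholesky_step)

lemma cholesky_remainder:
  assumes X: "positive_op X"
  shows "cinner x (cholesky e X N y) =
    cinner x (X y) - (\<Sum>n<N. cinner x (cholesky_vec e X n) * cinner (cholesky_vec e X n) y)"
proof (induction N)
  case (Suc N)
  define d where "d = Re (cinner (e N) (cholesky e X N (e N)))"
  have "0 \<le> d"
    unfolding d_def by (intro positive_opD(3) positive_op_cholesky X)
  then have "complex_of_real (sqrt d) * of_real (sqrt d) = of_real d"
    by (simp add: of_real_mult[symmetric] del: of_real_mult)
  then have "cinner x (cholesky_vec e X N) * cinner (cholesky_vec e X N) y =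
      cinner x (cholesky e X N (e N)) * cinner (cholesky e X N (e N)) y / of_real d"
    unfolding cholesky_vec_def cinner_simps d_def[symmetric]
    by (simp add: divide_simps)
  then show ?case
    using Suc by (simp add: cinner_cholesky_step d_def)
qed simp

lemma cholesky_decreasing:
  assumes X: "positive_op X" and "m \<le> n"
  shows "Re (cinner x (cholesky e X n x)) \<le> Re (cinner x (cholesky e X m x))"
  using \<open>m \<le> n\<close>
proof (induction rule: dec_induct)
  case (step n)
  have "Re (cinner x (cholesky e X (Suc n) x)) \<le> Re (cinner x (cholesky e X n x))"
    using positive_opD(3)[OF positive_op_cholesky[OF X, of e n], of "e n"]
    by (simp add: cholesky_step_quadratic[OF positive_op_cholesky[OF X]])
  with step show ?case
    by linarith
qed simp

text \<open>Step \<open>m\<close> clears the diagonal entry at \<open>e m\<close>. Later steps only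
  decrease the quadratic form, which stays nonnegative, so the entry remains 0.\<close>

lemma cholesky_vanishes:
  assumes X: "positive_op X" and "m < n"
  shows "Re (cinner (e m) (cholesky e X n (e m))) = 0"
proof -
  define d where "d = Re (cinner (e m) (cholesky e X m (e m)))"
  have "cinner (e m) (cholesky e X m (e m)) = of_real d"
    unfolding d_def by (rule positive_op_self) (rule positive_op_cholesky[OF X])
  then have "Re (cinner (e m) (cholesky e X (Suc m) (e m))) = 0"
    using cholesky_step_quadratic[OF positive_op_cholesky[OF X], of "e m" "e m" e m]
    by (simp add: power2_eq_square)
  moreover have "Re (cinner (e m) (cholesky e X n (e m))) \<le>
      Re (cinner (e m) (cholesky e X (Suc m) (e m)))"
    using assms by (intro cholesky_decreasing) auto
  ultimately show ?thesis
    using positive_opD(3)[OF positive_op_cholesky[OF X, of e n], of "e m"] by linarith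
qed

text \<open>R is the sum of |u n><u n|, read weakly through matrix elements. The vectors carry their
  weights in their norms, need not be orthogonal, and their square summability expresses a finite
  trace.\<close>

definition mixture :: "('a::complex_inner \<Rightarrow> 'a) \<Rightarrow> (nat \<Rightarrow> 'a) \<Rightarrow> bool"
  where "mixture R u \<longleftrightarrow> summable (\<lambda>n. (norm (u n))\<^sup>2) \<and>
    (\<forall>x y. ((\<lambda>n. cinner x (u n) * cinner (u n) y) has_sum cinner x (R y)) UNIV)"

text \<open>By the parallelogram law the vectors at which a bounded sequence of positive quadratic
  forms tends to zero form a closed subspace.\<close>

lemma positive_forms_tendsto_0:
  fixes Q :: "nat \<Rightarrow> 'a::complex_inner \<Rightarrow> 'a"
  assumes E: "orthonormal_basis E"
    and pos: "\<And>n. positive_op (Q n)"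
    and bound: "\<And>n x. Re (cinner x (Q n x)) \<le> K * (norm x)\<^sup>2"
    and basis: "\<And>b. b \<in> E \<Longrightarrow> (\<lambda>n. Re (cinner b (Q n b))) \<longlonglongrightarrow> 0"
  shows "(\<lambda>n. Re (cinner x (Q n x))) \<longlonglongrightarrow> 0"
proof -
  define s where "s n x = Re (cinner x (Q n x))" for n x
  have s0: "0 \<le> s n x" for n x
    unfolding s_def by (rule positive_opD(3)[OF pos])
  have s_add: "s n (x + y) \<le> 2 * s n x + 2 * s n y" for n x y
  proof -
    note lin = bounded_clinear_add[OF positive_opD(1)[OF pos]]
      bounded_clinear_diff[OF positive_opD(1)[OF pos]]
    have "s n (x + y) + s n (x - y) = 2 * s n x + 2 * s n y"
      unfolding s_def lin by (simp add: cinner_simps)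
    then show ?thesis
      using s0[of n "x - y"] by linarith
  qed
  have s_scale: "s n (c *\<^sub>C x) = (cmod c)\<^sup>2 * s n x" for n c x
  proof -
    have "cinner (c *\<^sub>C x) (Q n (c *\<^sub>C x)) = (c * cnj c) * cinner x (Q n x)"
      by (simp add: bounded_clinear_scaleC[OF positive_opD(1)[OF pos]] cinner_simps)
    then show ?thesis
      by (simp add: s_def complex_norm_square[symmetric])
  qed
  have span: "(\<lambda>n. s n y) \<longlonglongrightarrow> 0" if "y \<in> module.span scaleC E" for y
    using that
  proof (induction rule: module.span_induct_alt[OF complex_inner_module, consumes 1])
    case 1
    then show ?case
      by (simp add: s_def)
  next
    case (2 c b y)
    have "(\<lambda>n. 2 * ((cmod c)\<^sup>2 * s n b) + 2 * s n y) \<longlonglongrightarrow> 2 * ((cmod c)\<^sup>2 * 0) + 2 * 0"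
      using 2 basis unfolding s_def by (intro tendsto_intros) auto
    then show ?case
      using s_add[of _ "c *\<^sub>C b" y] s0
      by (intro tendsto_sandwich[of "\<lambda>_. 0" "\<lambda>n. s n (c *\<^sub>C b + y)" sequentially
            "\<lambda>n. 2 * ((cmod c)\<^sup>2 * s n b) + 2 * s n y"]) (auto simp: s_scale)
  qed
  have "(\<lambda>n. s n x) \<longlonglongrightarrow> 0"
  proof (rule LIMSEQ_I)
    fix r :: real
    assume "0 < r"
    \<comment> \<open>Chosen so that the forms at \<open>x - y\<close> are at most r/4 for all
      \<open>n\<close>. Together with a value below r/4 at \<open>y\<close>, the factor 2 in
      \<open>s_add\<close> leaves a total below \<open>r\<close>. Using |K| + 1 keeps the
      denominator positive.\<close>
    define \<delta> where "\<delta> = sqrt (r / (4 * (\<bar>K\<bar> + 1)))"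
    have "0 < \<bar>K\<bar> + 1"
      by simp
    then have \<delta>: "0 < \<delta>" "\<delta>\<^sup>2 * (\<bar>K\<bar> + 1) = r / 4"
      using \<open>0 < r\<close> by (simp_all add: \<delta>_def real_sqrt_pow2_iff divide_simps)
    have "x \<in> closure (module.span scaleC E)"
      using E by (auto simp: orthonormal_basis_def)
    then obtain y where y: "y \<in> module.span scaleC E" "dist y x < \<delta>"
      using \<delta>(1) by (auto simp: closure_approachable)
    have diff: "s n (x - y) \<le> r / 4" for n
    proof -
      have "(norm (x - y))\<^sup>2 \<le> \<delta>\<^sup>2"
        using y(2) by (intro power_mono) (auto simp: dist_norm norm_minus_commute)
      then have "(\<bar>K\<bar> + 1) * (norm (x - y))\<^sup>2 \<le> (\<bar>K\<bar> + 1) * \<delta>\<^sup>2"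
        by (intro mult_left_mono) auto
      moreover have "K * (norm (x - y))\<^sup>2 \<le> (\<bar>K\<bar> + 1) * (norm (x - y))\<^sup>2"
        by (intro mult_right_mono) auto
      ultimately show ?thesis
        using bound[of "x - y" n] \<delta>(2) unfolding s_def by (simp add: mult.commute)
    qed
    obtain N where N: "\<And>n. N \<le> n \<Longrightarrow> \<bar>s n y\<bar> < r / 4"
      using LIMSEQ_D[OF span[OF y(1)], of "r / 4"] \<open>0 < r\<close> by auto
    have "norm (s n x - 0) < r" if "N \<le> n" for n
      using diff[of n] N[OF that] s_add[of n "x - y" y] s0[of n x] by simp
    then show "\<exists>N. \<forall>n\<ge>N. norm (s n x - 0) < r"
      by blast
  qed
  then show ?thesis
    by (simp add: s_def)
qed

lemma norm_rank_one_le: "cmod (cinner x u * cinner u y) \<le> norm x * norm y * (norm u)\<^sup>2"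
proof -
  have "cmod (cinner x u * cinner u y) \<le> (norm x * norm u) * (norm u * norm y)"
    unfolding norm_mult by (intro mult_mono cinner_Cauchy_Schwarz) auto
  then show ?thesis
    by (simp add: power2_eq_square mult_ac)
qed

text \<open>A convergent trace has only countably many nonzero diagonal entries, so elimination
  along one sequence reaches all of them, even when the basis is uncountable. The remainders then
  tend to 0 at every basis vector, hence at every vector, and by Cauchy--Schwarz in every matrix
  element.\<close>

lemma positive_trace_class_mixture:
  fixes X :: "'a::complex_inner \<Rightarrow> 'a"
  assumes X: "positive_op X" and E: "orthonormal_basis E"
    and trace: "((\<lambda>b. Re (cinner b (X b))) has_sum T) E"
  obtains u where "mixture X u" "(\<Sum>n. (norm (u n))\<^sup>2) \<le> T"
proof -
  define C where "C = {b \<in> E. Re (cinner b (X b)) \<noteq> 0}"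
  \<comment> \<open>If \<open>C\<close> is finite the enumeration repeats or invents vectors. This
    is harmless: the remainder identity and the monotonicity hold along any sequence.\<close>
  define e where "e = from_nat_into C"
  define u where "u = cholesky_vec e X"
  let ?Q = "cholesky e X"
  have "countable C"
    unfolding C_def using trace by (intro summable_countable_real) (auto simp: summable_on_def)
  obtain K where K: "\<And>x. norm (X x) \<le> norm x * K"
    using positive_opD(1)[OF X] bounded_linear.bounded unfolding bounded_clinear_def by blast
  have rem: "Re (cinner x (?Q n x)) \<le> Re (cinner x (X x))" for n x
    using cholesky_decreasing[OF X, of 0 n x e] by simp
  have bound: "Re (cinner x (?Q n x)) \<le> K * (norm x)\<^sup>2" for n x
  proof -
    have "Re (cinner x (X x)) \<le> norm x * norm (X x)"
      using complex_Re_le_cmod cinner_Cauchy_Schwarz order_trans by blast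
    also have "\<dots> \<le> norm x * (norm x * K)"
      by (intro mult_left_mono K) simp
    finally show ?thesis
      using rem[of x n] by (simp add: power2_eq_square mult_ac)
  qed
  have basis: "(\<lambda>n. Re (cinner b (?Q n b))) \<longlonglongrightarrow> 0" if "b \<in> E" for b
  proof (cases "b \<in> C")
    case True
    then obtain m where "b = e m"
      using from_nat_into_surj[OF \<open>countable C\<close>] unfolding e_def by metis
    then have "\<forall>\<^sub>F n in sequentially. Re (cinner b (?Q n b)) = 0"
      by (intro eventually_mono[OF eventually_gt_at_top[of m]])
         (simp add: cholesky_vanishes[OF X] \<open>b = e m\<close>)
    then show ?thesis
      by (rule tendsto_eventually)
  next
    case False
    then have "Re (cinner b (?Q n b)) = 0" for n
      using rem[of b n] that positive_opD(3)[OF positive_op_cholesky[OF X, of e n], of b]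
      by (auto simp: C_def)
    then show ?thesis
      by simp
  qed
  have quad: "(\<lambda>n. Re (cinner x (?Q n x))) \<longlonglongrightarrow> 0" for x
    by (rule positive_forms_tendsto_0[OF E positive_op_cholesky[OF X] bound basis])
  have sums: "(\<lambda>n. cinner x (u n) * cinner (u n) y) sums cinner x (X y)" for x y
  proof -
    have "(\<lambda>n. sqrt (Re (cinner x (?Q n x)) * Re (cinner y (?Q n y)))) \<longlonglongrightarrow> sqrt (0 * 0)"
      by (intro tendsto_real_sqrt tendsto_mult quad)
    moreover have le: "norm (cinner x (?Q n y)) \<le> sqrt (Re (cinner x (?Q n x)) * Re (cinner y (?Q n y)))" for n
      using positive_op_Cauchy_Schwarz[OF positive_op_cholesky[OF X]] by (rule real_le_rsqrt)
    ultimately have "(\<lambda>n. cinner x (?Q n y)) \<longlonglongrightarrow> 0"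
      by (intro Lim_null_comparison[OF always_eventually[OF allI[OF le]]]) simp
    then have "(\<lambda>n. cinner x (X y) - cinner x (?Q n y)) \<longlonglongrightarrow> cinner x (X y) - 0"
      by (intro tendsto_intros)
    then show ?thesis
      by (simp add: sums_def cholesky_remainder[OF X] u_def)
  qed
  \<comment> \<open>Parseval rewrites the squared norms as sums over \<open>E\<close>. There each
    term is bounded by a diagonal entry of \<open>X\<close>, since the remainder after
    \<open>N\<close> steps is positive.\<close>
  have partial: "(\<Sum>n<N. (norm (u n))\<^sup>2) \<le> T" for N
  proof -
    have "((\<lambda>b. \<Sum>n<N. (cmod (cinner b (u n)))\<^sup>2) has_sum (\<Sum>n<N. (norm (u n))\<^sup>2)) E"
    proof (induction N)
      case (Suc N)
      then show ?case
        unfolding sum.lessThan_Suc by (intro has_sum_add parseval_norm E)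
    qed simp
    then show ?thesis
    proof (rule has_sum_mono[OF _ trace])
      fix b
      have "cinner b (u n) * cinner (u n) b = of_real ((cmod (cinner b (u n)))\<^sup>2)" for n
        by (metis cinner_commute complex_norm_square)
      then show "(\<Sum>n<N. (cmod (cinner b (u n)))\<^sup>2) \<le> Re (cinner b (X b))"
        using cholesky_remainder[OF X, of b e N b]
          positive_opD(3)[OF positive_op_cholesky[OF X, of e N], of b]
        by (simp add: u_def)
    qed
  qed
  have summable: "summable (\<lambda>n. (norm (u n))\<^sup>2)"
    using partial by (intro summableI_nonneg_bounded) auto
  \<comment> \<open>Absolute convergence upgrades the ordered series to an unordered sum.\<close>
  have "summable (\<lambda>n. cmod (cinner x (u n) * cinner (u n) y))" for x y
    by (rule summable_comparison_test'[OF summable_mult[OF summable, of "norm x * norm y"]])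
       (simp add: norm_rank_one_le del: norm_mult)
  then have "((\<lambda>n. cinner x (u n) * cinner (u n) y) has_sum cinner x (X y)) UNIV" for x y
    by (rule norm_summable_imp_has_sum) (rule sums)
  then have "mixture X u"
    using summable by (simp add: mixture_def)
  moreover have "(\<Sum>n. (norm (u n))\<^sup>2) \<le> T"
    using summable partial by (rule suminf_le_const)
  ultimately show ?thesis
    using that by blast
qed

section \<open>Images and traces of mixtures\<close>

lemma mixture_map:
  assumes mix: "mixture R u"
    and adj: "\<And>x y. cinner (T x) y = cinner x (T' y)"
    and bound: "\<And>x. norm (T x) \<le> K * norm x"
  shows "mixture (T \<circ> R \<circ> T') (\<lambda>n. T (u n))"
proof -
  have adj': "cinner x (T y) = cinner (T' x) y" for x y
    by (metis adj cinner_commute)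
  have le: "norm ((norm (T (u n)))\<^sup>2) \<le> K\<^sup>2 * (norm (u n))\<^sup>2" for n
    using power_mono[OF bound[of "u n"], of 2] by (simp add: power_mult_distrib)
  have "summable (\<lambda>n. K\<^sup>2 * (norm (u n))\<^sup>2)"
    using mix by (intro summable_mult) (simp add: mixture_def)
  then have "summable (\<lambda>n. (norm (T (u n)))\<^sup>2)"
    by (rule summable_comparison_test') (rule le)
  then show ?thesis
    using mix by (auto simp: mixture_def adj adj')
qed

text \<open>Exchange of summation in the double family <u n|b><b|M u n>. Summing over
  \<open>b\<close> first gives <u n|M u n> by Parseval; summing over \<open>n\<close> first gives
  the diagonal entries of the product. The exchange is justified by the majorant \<open>h\<close>,
  since ab is at most a^2 + b^2 for nonnegative a and b.\<close>

lemma trace_op_mixture: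
  fixes R M :: "'a::complex_inner \<Rightarrow> 'a"
  assumes basis: "orthonormal_basis (B :: 'a set)"
    and mix: "mixture R u" and M: "positive_op M"
  shows "(\<lambda>n. Re (cinner (u n) (M (u n)))) sums Re (trace_op (M \<circ> R))"
proof -
  \<comment> \<open>The basis \<open>B\<close> guarantees that the choice inside
    \<open>trace_op\<close> really is an orthonormal basis.\<close>
  define E :: "'a set" where "E = (SOME E. orthonormal_basis E)"
  have E: "orthonormal_basis E"
    unfolding E_def using basis by (rule someI)
  obtain K where K: "\<And>x. norm (M x) \<le> norm x * K"
    using positive_opD(1)[OF M] bounded_linear.bounded unfolding bounded_clinear_def by blast
  define g where "g = (\<lambda>(n, b). cinner (u n) b * cinner b (M (u n)))"
  define h where "h = (\<lambda>(n, b). (cmod (cinner b (u n)))\<^sup>2 + (cmod (cinner b (M (u n))))\<^sup>2)"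
  have "h summable_on (UNIV \<times> E)"
  proof (rule summable_on_SigmaI)
    show "((\<lambda>b. h (n, b)) has_sum ((norm (u n))\<^sup>2 + (norm (M (u n)))\<^sup>2)) E" for n
      by (auto simp: h_def intro!: has_sum_add parseval_norm E)
    have le: "norm ((norm (u n))\<^sup>2 + (norm (M (u n)))\<^sup>2) \<le> (1 + K\<^sup>2) * (norm (u n))\<^sup>2" for n
      using power_mono[OF K[of "u n"], of 2]
      by (simp add: power_mult_distrib mult.commute distrib_right)
    have "summable (\<lambda>n. (1 + K\<^sup>2) * (norm (u n))\<^sup>2)"
      using mix by (intro summable_mult) (simp add: mixture_def)
    then have "summable (\<lambda>n. (norm (u n))\<^sup>2 + (norm (M (u n)))\<^sup>2)"
      by (rule summable_comparison_test') (rule le)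
    then show "(\<lambda>n. (norm (u n))\<^sup>2 + (norm (M (u n)))\<^sup>2) summable_on UNIV"
      by (simp add: summable_on_UNIV_nonneg_real_iff)
  qed (auto simp: h_def)
  moreover have "norm (g p) \<le> h p" for p
  proof -
    have *: "a * b \<le> a\<^sup>2 + b\<^sup>2" if "0 \<le> a" "0 \<le> b" for a b :: real
      using sum_squares_bound[of a b] that mult_nonneg_nonneg[of a b] by linarith
    show ?thesis
      using *[of "cmod (cinner b (u n))" "cmod (cinner b (M (u n)))" for n b]
      by (cases p) (auto simp: g_def h_def norm_mult cinner_commute[of "u _"])
  qed
  ultimately have "g summable_on (UNIV \<times> E)"
    by (rule abs_summable_summable[OF Infinite_Sum.abs_summable_on_comparison_test'])
  then obtain S where S: "(g has_sum S) (UNIV \<times> E)"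
    by (auto simp: summable_on_def)
  have "((\<lambda>n. cinner (u n) (M (u n))) has_sum S) UNIV"
    by (rule has_sum_SigmaD[OF S]) (auto simp: g_def intro: parseval[OF E])
  then have "(\<lambda>n. Re (cinner (u n) (M (u n)))) sums Re S"
    by (intro has_sum_imp_sums has_sum_Re)
  moreover have "((\<lambda>b. cinner b (M (R b))) has_sum S) E"
  proof (rule has_sum_SigmaD[OF S[THEN has_sum_swap[THEN iffD1]]])
    fix b
    have "((\<lambda>n. cinner (M b) (u n) * cinner (u n) b) has_sum cinner (M b) (R b)) UNIV"
      using mix by (simp add: mixture_def)
    then show "((\<lambda>n. (\<lambda>(b, n). g (n, b)) (b, n)) has_sum cinner b (M (R b))) UNIV"
      by (simp add: g_def positive_op_hermitian[OF M] mult.commute)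
  qed
  then have "trace_op (M \<circ> R) = S"
    by (simp add: trace_op_def E_def infsumI)
  ultimately show ?thesis
    by simp
qed

section \<open>Unitary evolution\<close>

lemma bounded_linear_scaleC: "bounded_linear (\<lambda>x::'a::complex_inner. c *\<^sub>C x)"
  by (rule bounded_linear_intro[where K = "cmod c"])
     (simp_all add: scaleC_add_right scaleR_scaleC scaleC_scaleC norm_scaleC mult.commute)

text \<open>Termwise differentiation on a ball around 0 that contains \<open>t\<close>. The series
  of derivatives converges uniformly there by the Weierstrass test, with the hypothesis taken at the
  radius |t| + 1.\<close>

lemma power_series_has_vector_derivative:
  fixes v :: "nat \<Rightarrow> 'b::banach"
  assumes summable: "\<And>R. summable (\<lambda>n. real (Suc n) * R ^ n * norm (v (Suc n)))"
  shows "summable (\<lambda>n. t ^ n *\<^sub>R v n)"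
    and "((\<lambda>t. \<Sum>n. t ^ n *\<^sub>R v n) has_vector_derivative
      (\<Sum>n. (real (Suc n) * t ^ n) *\<^sub>R v (Suc n))) (at t)"
proof -
  \<comment> \<open>At \<open>n = 0\<close> the truncated exponent \<open>n - 1\<close> does no
    harm, because the factor \<open>real n\<close> is 0.\<close>
  define w where "w n s = (real n * s ^ (n - 1)) *\<^sub>R v n" for n and s :: real
  define S where "S = ball (0::real) (\<bar>t\<bar> + 1)"
  have tS: "t \<in> S"
    by (simp add: S_def dist_norm)
  have deriv: "((\<lambda>s. s ^ n *\<^sub>R v n) has_derivative (\<lambda>h. h *\<^sub>R w n s)) (at s within S)" for n s
    unfolding w_def by (auto intro!: derivative_eq_intros simp: mult_ac)
  define M where "M n = real n * (\<bar>t\<bar> + 1) ^ (n - 1) * norm (v n)" for n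
  have "summable (\<lambda>n. M (Suc n))"
    using summable[of "\<bar>t\<bar> + 1"] by (simp add: M_def)
  then have M: "summable M"
    by (simp only: summable_Suc_iff)
  have bound: "norm (w n s) \<le> M n" if "s \<in> S" for n s
    using that unfolding w_def M_def S_def
    by (auto intro!: mult_right_mono mult_left_mono power_mono simp: power_abs dist_norm abs_mult)
  have lim: "uniform_limit S (\<lambda>n s. \<Sum>i<n. w i s) (\<lambda>s. \<Sum>i. w i s) sequentially"
    using bound M by (rule Weierstrass_m_test)
  have "\<exists>g. \<forall>s\<in>S. (\<lambda>n. s ^ n *\<^sub>R v n) sums g s \<and>
    (g has_derivative (\<lambda>h. h *\<^sub>R (\<Sum>i. w i s))) (at s within S)"
  proof (rule has_derivative_series[OF _ deriv])
    fix e :: real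
    assume "0 < e"
    have "\<forall>\<^sub>F n in sequentially. \<forall>s\<in>S. dist (\<Sum>i<n. w i s) (\<Sum>i. w i s) < e"
      using lim \<open>0 < e\<close> unfolding uniform_limit_iff by blast
    then show "\<forall>\<^sub>F n in sequentially. \<forall>s\<in>S. \<forall>h.
        norm ((\<Sum>i<n. h *\<^sub>R w i s) - h *\<^sub>R (\<Sum>i. w i s)) \<le> e * norm h"
    proof (rule eventually_mono, intro ballI allI)
      fix n s and h :: real
      assume "\<forall>s\<in>S. dist (\<Sum>i<n. w i s) (\<Sum>i. w i s) < e" "s \<in> S"
      then have le: "norm ((\<Sum>i<n. w i s) - (\<Sum>i. w i s)) \<le> e"
        by (auto simp: dist_norm intro: less_imp_le)
      have "(\<Sum>i<n. h *\<^sub>R w i s) - h *\<^sub>R (\<Sum>i. w i s) = h *\<^sub>R ((\<Sum>i<n. w i s) - (\<Sum>i. w i s))"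
        by (simp add: scaleR_sum_right scaleR_diff_right)
      then show "norm ((\<Sum>i<n. h *\<^sub>R w i s) - h *\<^sub>R (\<Sum>i. w i s)) \<le> e * norm h"
        using mult_left_mono[OF le, of "\<bar>h\<bar>"] by (simp add: mult.commute)
    qed
  next
    show "(\<lambda>n. 0 ^ n *\<^sub>R v n) sums v 0"
    proof -
      have "(\<lambda>n. 0 ^ n *\<^sub>R v n) = (\<lambda>n. if n = 0 then v n else 0)"
        by (auto simp: power_0_left)
      then show ?thesis
        using sums_single[of 0 v] by simp
    qed
    show "0 \<in> S" "convex S"
      by (auto simp: S_def)
  qed
  then obtain g where g: "\<And>s. s \<in> S \<Longrightarrow> (\<lambda>n. s ^ n *\<^sub>R v n) sums g s"
    and g': "(g has_derivative (\<lambda>h. h *\<^sub>R (\<Sum>i. w i t))) (at t within S)"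
    using tS by blast
  show "summable (\<lambda>n. t ^ n *\<^sub>R v n)"
    using g[OF tS] by (rule sums_summable)
  have "open S"
    by (simp add: S_def)
  have "(g has_vector_derivative (\<Sum>i. w i t)) (at t)"
    using g' unfolding at_within_open[OF tS \<open>open S\<close>] has_vector_derivative_def .
  then have "((\<lambda>t. \<Sum>n. t ^ n *\<^sub>R v n) has_vector_derivative (\<Sum>i. w i t)) (at t)"
    by (rule has_vector_derivative_transform_within_open[OF _ \<open>open S\<close> tS])
       (simp add: sums_unique[OF g])
  \<comment> \<open>The term of index 0 is the derivative of a constant, so the index can be
    shifted.\<close>
  moreover have "(\<Sum>i. w i t) = (\<Sum>i. w (Suc i) t)"
  proof -
    have "summable (\<lambda>n. norm (w n t))"
      using bound[OF tS] by (intro summable_comparison_test'[OF M, of 0]) simp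
    then have "summable (\<lambda>n. w n t)"
      by (rule summable_norm_cancel)
    then show ?thesis
      by (subst suminf_split_head) (simp_all add: w_def)
  qed
  ultimately show "((\<lambda>t. \<Sum>n. t ^ n *\<^sub>R v n) has_vector_derivative
      (\<Sum>n. (real (Suc n) * t ^ n) *\<^sub>R v (Suc n))) (at t)"
    by (simp add: w_def)
qed

section \<open>The exponential series of a bounded operator and its unitarity\<close>

lemma hermitian_opD:
  assumes "hermitian_op A"
  shows "bounded_clinear A" "cinner (A x) y = cinner x (A y)"
  using assms by (auto simp: hermitian_op_def)

text \<open>Splitting off t^n turns the exponential into a real power series with vector
  coefficients \<open>v x n\<close>. Differentiating its term n + 1 reproduces -iA applied to term
  n, since the factor n + 1 cancels against the factorial; the same cancellation leaves an
  exponential majorant.\<close>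

lemma evolution_coefficients:
  fixes A :: "'a::complex_inner \<Rightarrow> 'a"
  assumes A: "bounded_clinear A"
  defines "v \<equiv> \<lambda>x n. ((- \<i>) ^ n / fact n) *\<^sub>C (A ^^ n) x"
  shows "((- \<i> * complex_of_real t) ^ n / fact n) *\<^sub>C (A ^^ n) x = t ^ n *\<^sub>R v x n"
    and "(real (Suc n) * t ^ n) *\<^sub>R v x (Suc n) = (- \<i>) *\<^sub>C A (t ^ n *\<^sub>R v x n)"
    and "summable (\<lambda>n. real (Suc n) * R ^ n * norm (v x (Suc n)))"
proof -
  show "((- \<i> * complex_of_real t) ^ n / fact n) *\<^sub>C (A ^^ n) x = t ^ n *\<^sub>R v x n"
    unfolding power_mult_distrib by (simp add: v_def scaleR_scaleC scaleC_scaleC mult_ac)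
  have "of_nat (Suc n) * ((- \<i>) ^ Suc n / fact (Suc n)) = - \<i> * ((- \<i>) ^ n / fact n)"
    by (simp add: divide_simps del: of_nat_Suc)
  then have Suc: "of_nat (Suc n) * (c * ((- \<i>) ^ Suc n / fact (Suc n))) =
      - \<i> * (c * ((- \<i>) ^ n / fact n))" for c
    by (metis mult.left_commute)
  show "(real (Suc n) * t ^ n) *\<^sub>R v x (Suc n) = (- \<i>) *\<^sub>C A (t ^ n *\<^sub>R v x n)"
    using Suc[of "of_real t ^ n"]
    by (simp add: v_def scaleR_scaleC scaleC_scaleC bounded_clinear_scaleC[OF A] mult.assoc
        del: of_nat_Suc power_Suc fact_Suc)
  obtain K where K: "0 \<le> K" "\<And>x. norm (A x) \<le> norm x * K"
    using A bounded_linear.nonneg_bounded unfolding bounded_clinear_def by blast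
  have pow: "norm ((A ^^ n) x) \<le> K ^ n * norm x" for n
  proof (induction n)
    case (Suc n)
    have "norm ((A ^^ Suc n) x) \<le> norm ((A ^^ n) x) * K"
      using K(2) by simp
    also have "\<dots> \<le> (K ^ n * norm x) * K"
      by (intro mult_right_mono Suc K)
    finally show ?case
      by (simp add: mult_ac)
  qed simp
  show "summable (\<lambda>n. real (Suc n) * R ^ n * norm (v x (Suc n)))"
  proof (rule summable_comparison_test')
    have "summable (\<lambda>n. (K * norm x) * ((\<bar>R\<bar> * K) ^ n / fact n))"
      using summable_exp_generic[of "\<bar>R\<bar> * K"]
      by (intro summable_mult) (simp add: divide_inverse mult.commute)
    then show "summable (\<lambda>n. (K * norm x) * ((\<bar>R\<bar> * K) ^ n / fact n))" .
    fix n
    have "norm (v x (Suc n)) \<le> K ^ Suc n * norm x / fact (Suc n)"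
      using pow[of "Suc n"] unfolding v_def norm_scaleC
      by (simp add: norm_divide norm_power divide_right_mono del: fact_Suc funpow.simps power_Suc)
    then have "real (Suc n) * \<bar>R\<bar> ^ n * norm (v x (Suc n)) \<le>
        real (Suc n) * \<bar>R\<bar> ^ n * (K ^ Suc n * norm x / fact (Suc n))"
      by (intro mult_left_mono) auto
    also have "\<dots> = (K * norm x) * ((\<bar>R\<bar> * K) ^ n / fact n)"
      by (simp add: divide_simps power_mult_distrib del: of_nat_Suc)
    finally show "norm (real (Suc n) * R ^ n * norm (v x (Suc n))) \<le>
        (K * norm x) * ((\<bar>R\<bar> * K) ^ n / fact n)"
      by (simp add: abs_mult power_abs)
  qed
qed

lemma evolution_sums:
  fixes A :: "'a::chilbert_space \<Rightarrow> 'a"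
  assumes A: "bounded_clinear A"
  shows "(\<lambda>n. ((- \<i> * complex_of_real t) ^ n / fact n) *\<^sub>C (A ^^ n) x) sums evolution A t x"
  unfolding evolution_def evolution_coefficients(1)[OF A]
  by (intro summable_sums power_series_has_vector_derivative evolution_coefficients(3)[OF A])

text \<open>The Schroedinger equation: the continuous operator -iA may be applied to the exponential
  series term by term, and the result is the differentiated series.\<close>

lemma evolution_has_vector_derivative:
  fixes A :: "'a::chilbert_space \<Rightarrow> 'a"
  assumes A: "bounded_clinear A"
  shows "((\<lambda>t. evolution A t x) has_vector_derivative (- \<i>) *\<^sub>C A (evolution A t x)) (at t)"
proof -
  have "bounded_linear (\<lambda>x. (- \<i>) *\<^sub>C A x)"
    using A bounded_linear_compose[OF bounded_linear_scaleC] unfolding bounded_clinear_def by blast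
  then have "(\<lambda>n. (- \<i>) *\<^sub>C A (((- \<i> * complex_of_real t) ^ n / fact n) *\<^sub>C (A ^^ n) x))
      sums ((- \<i>) *\<^sub>C A (evolution A t x))"
    using evolution_sums[OF A] by (rule bounded_linear.sums)
  then have "(- \<i>) *\<^sub>C A (evolution A t x) =
      (\<Sum>n. (real (Suc n) * t ^ n) *\<^sub>R (((- \<i>) ^ Suc n / fact (Suc n)) *\<^sub>C (A ^^ Suc n) x))"
    unfolding evolution_coefficients(2)[OF A] evolution_coefficients(1)[OF A] by (rule sums_unique)
  then show ?thesis
    unfolding evolution_def[abs_def] evolution_coefficients(1)[OF A]
    using power_series_has_vector_derivative(2)[OF evolution_coefficients(3)[OF A], of x t] by simp
qed

lemma evolution_zero:
  fixes A :: "'a::chilbert_space \<Rightarrow> 'a"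
  shows "evolution A 0 x = x"
proof -
  have "(\<lambda>n. ((- \<i> * complex_of_real 0) ^ n / fact n) *\<^sub>C (A ^^ n) x) =
      (\<lambda>n. if n = 0 then x else 0)"
    by (rule ext) (simp add: power_0_left scaleC_one module.scale_zero_left[OF complex_inner_module])
  then show ?thesis
    using sums_single[of 0 "\<lambda>_. x"] unfolding evolution_def by (simp add: sums_iff)
qed

text \<open>Term by term, \<open>A\<close> moves across the inner product and conjugation turns -it
  into it.\<close>

lemma evolution_adjoint:
  fixes A :: "'a::chilbert_space \<Rightarrow> 'a"
  assumes A: "hermitian_op A"
  shows "cinner (evolution A t x) y = cinner x (evolution A (- t) y)"
proof -
  have pow: "cinner ((A ^^ n) x) y = cinner x ((A ^^ n) y)" for n x y
    by (induction n arbitrary: x) (simp_all add: funpow_swap1 hermitian_opD(2)[OF A])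
  have "(\<lambda>n. cinner (((- \<i> * complex_of_real t) ^ n / fact n) *\<^sub>C (A ^^ n) x) y)
      sums cinner (evolution A t x) y"
    using bounded_bilinear.bounded_linear_left[OF bounded_bilinear_cinner]
      evolution_sums[OF hermitian_opD(1)[OF A]]
    by (rule bounded_linear.sums)
  moreover have "(\<lambda>n. cinner x (((- \<i> * complex_of_real (- t)) ^ n / fact n) *\<^sub>C (A ^^ n) y))
      sums cinner x (evolution A (- t) y)"
    using bounded_bilinear.bounded_linear_right[OF bounded_bilinear_cinner]
      evolution_sums[OF hermitian_opD(1)[OF A]]
    by (rule bounded_linear.sums)
  ultimately show ?thesis
    by (simp add: cinner_simps pow sums_iff)
qed

text \<open>An adjoint is determined by its matrix elements, so any candidate is the one chosen by
  \<open>SOME\<close>.\<close>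

lemma cadjoint_eqI:
  assumes "\<And>x y. cinner (Y x) y = cinner x (X y)"
  shows "cadjoint X = Y"
proof -
  have "\<forall>x y. cinner (cadjoint X x) y = cinner x (X y)"
    unfolding cadjoint_def by (rule someI[of _ Y]) (simp add: assms)
  then have "cinner z (cadjoint X x) = cinner z (Y x)" for x z
    by (metis assms cinner_commute)
  then show ?thesis
    by (auto intro: cinner_ext)
qed

text \<open>The derivative of <w|w> is <w|-iAw> + <-iAw|w>, which vanishes because \<open>A\<close>
  is symmetric. So <w|w> keeps its value from time 0.\<close>

lemma evolution_norm:
  fixes A :: "'a::chilbert_space \<Rightarrow> 'a"
  assumes A: "hermitian_op A"
  shows "norm (evolution A t x) = norm x"
proof -
  have "((\<lambda>t. cinner (evolution A t x) (evolution A t x)) has_vector_derivative 0) (at t within UNIV)" for t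
    using bounded_bilinear.has_vector_derivative[OF bounded_bilinear_cinner
      evolution_has_vector_derivative[OF hermitian_opD(1)[OF A]]
      evolution_has_vector_derivative[OF hermitian_opD(1)[OF A]]]
    by (simp add: cinner_simps hermitian_opD(2)[OF A])
  then have "((\<lambda>t. cinner (evolution A t x) (evolution A t x)) has_derivative (\<lambda>h. 0))
      (at t within UNIV)" for t
    by (simp add: has_vector_derivative_def)
  then have "cinner (evolution A t x) (evolution A t x) = cinner (evolution A 0 x) (evolution A 0 x)"
    by (rule Derivative.has_derivative_zero_unique[OF convex_UNIV]) auto
  then have "cinner (evolution A t x) (evolution A t x) = cinner x x"
    by (simp add: evolution_zero)
  then show ?thesis
    by (simp add: norm_eq_sqrt_cinner)
qed

lemma mixture_evolved_state:
  fixes A :: "'a::chilbert_space \<Rightarrow> 'a"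
  assumes A: "hermitian_op A" and mix: "mixture \<rho> u"
  shows "mixture (evolved_state A \<rho> t) (\<lambda>n. evolution A t (u n))"
proof -
  have "cadjoint (evolution A t) = evolution A (- t)"
    using evolution_adjoint[OF A, of "- t"] by (intro cadjoint_eqI) simp
  then show ?thesis
    unfolding evolved_state_def
    using mixture_map[OF mix evolution_adjoint[OF A, of t], where K = 1] evolution_norm[OF A] by simp
qed

section \<open>Quadratic forms along the evolution of a mixture\<close>

lemma summable_positive_form:
  assumes G: "positive_op G" and u: "summable (\<lambda>n. (norm (u n))\<^sup>2)"
  shows "summable (\<lambda>n. Re (cinner (u n) (G (u n))))"
proof -
  obtain K where K: "\<And>x. norm (G x) \<le> norm x * K"
    using positive_opD(1)[OF G] bounded_linear.bounded unfolding bounded_clinear_def by blast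
  have "norm (Re (cinner (u n) (G (u n)))) \<le> K * (norm (u n))\<^sup>2" for n
  proof -
    have "norm (Re (cinner (u n) (G (u n)))) \<le> norm (u n) * norm (G (u n))"
      using abs_Re_le_cmod cinner_Cauchy_Schwarz order_trans by (metis real_norm_def)
    also have "\<dots> \<le> norm (u n) * (norm (u n) * K)"
      by (intro mult_left_mono K) simp
    finally show ?thesis
      by (simp add: power2_eq_square mult_ac)
  qed
  then show ?thesis
    by (rule summable_comparison_test'[OF summable_mult[OF u]])
qed

text \<open>The product rule gives a derivative plus its conjugate in each term. As the evolution
  preserves norms, these derivatives have a summable bound independent of \<open>t\<close>, so the
  series may be differentiated termwise on the whole line.\<close>

lemma mixture_form_has_derivative:
  fixes A G :: "'a::chilbert_space \<Rightarrow> 'a"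
  assumes A: "hermitian_op A" and G: "positive_op G" and u: "summable (\<lambda>n. (norm (u n))\<^sup>2)"
  defines "w \<equiv> \<lambda>t n. evolution A t (u n)"
  defines "D \<equiv> \<lambda>t n. 2 * Re (cinner (w t n) (G ((- \<i>) *\<^sub>C A (w t n))))"
  shows "summable (D t)"
    and "((\<lambda>t. \<Sum>n. Re (cinner (w t n) (G (w t n)))) has_real_derivative (\<Sum>n. D t n)) (at t)"
proof -
  note A' = hermitian_opD(1)[OF A]
  have linG: "bounded_linear G"
    using positive_opD(1)[OF G] by (simp add: bounded_clinear_def)
  obtain K where K: "\<And>x. norm (G x) \<le> norm x * K" "0 \<le> K"
    using bounded_linear.nonneg_bounded[OF linG] by blast
  obtain L where L: "\<And>x. norm (A x) \<le> norm x * L" "0 \<le> L"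
    using A' bounded_linear.nonneg_bounded unfolding bounded_clinear_def by blast
  have deriv: "((\<lambda>t. Re (cinner (w t n) (G (w t n)))) has_real_derivative D t n) (at t)" for t n
  proof -
    have w': "((\<lambda>t. w t n) has_vector_derivative (- \<i>) *\<^sub>C A (w t n)) (at t)"
      unfolding w_def by (rule evolution_has_vector_derivative[OF A'])
    then have "((\<lambda>t. G (w t n)) has_vector_derivative G ((- \<i>) *\<^sub>C A (w t n))) (at t)"
      by (rule bounded_linear.has_vector_derivative[OF linG])
    then have "((\<lambda>t. cinner (w t n) (G (w t n))) has_vector_derivative
        (cinner (w t n) (G ((- \<i>) *\<^sub>C A (w t n))) + cinner ((- \<i>) *\<^sub>C A (w t n)) (G (w t n)))) (at t)"
      by (rule bounded_bilinear.has_vector_derivative[OF bounded_bilinear_cinner w'])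
    then have "((\<lambda>t. Re (cinner (w t n) (G (w t n)))) has_vector_derivative
        Re (cinner (w t n) (G ((- \<i>) *\<^sub>C A (w t n))) + cinner ((- \<i>) *\<^sub>C A (w t n)) (G (w t n)))) (at t)"
      by (rule bounded_linear.has_vector_derivative[OF bounded_linear_Re])
    moreover have "cinner ((- \<i>) *\<^sub>C A (w t n)) (G (w t n)) = cnj (cinner (w t n) (G ((- \<i>) *\<^sub>C A (w t n))))"
      by (metis cinner_commute positive_op_hermitian[OF G])
    ultimately show ?thesis
      by (simp add: D_def has_real_derivative_iff_has_vector_derivative)
  qed
  have bound: "norm (D t n) \<le> 2 * (L * K) * (norm (u n))\<^sup>2" for t n
  proof -
    have "norm (G ((- \<i>) *\<^sub>C A (w t n))) \<le> norm (A (w t n)) * K"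
      using K(1)[of "(- \<i>) *\<^sub>C A (w t n)"] by (simp add: norm_scaleC)
    also have "\<dots> \<le> (norm (w t n) * L) * K"
      by (intro mult_right_mono L K)
    finally have "norm (w t n) * norm (G ((- \<i>) *\<^sub>C A (w t n))) \<le> norm (w t n) * ((norm (w t n) * L) * K)"
      by (intro mult_left_mono) auto
    moreover have "\<bar>Re (cinner (w t n) (G ((- \<i>) *\<^sub>C A (w t n))))\<bar> \<le>
        norm (w t n) * norm (G ((- \<i>) *\<^sub>C A (w t n)))"
      using abs_Re_le_cmod cinner_Cauchy_Schwarz by (rule order_trans)
    ultimately show ?thesis
      by (simp add: D_def abs_mult w_def evolution_norm[OF A] power2_eq_square mult_ac)
  qed
  have M: "summable (\<lambda>n. 2 * (L * K) * (norm (u n))\<^sup>2)"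
    by (intro summable_mult u)
  show "summable (D t)"
    by (rule summable_comparison_test'[OF M]) (rule bound)
  have unif: "uniformly_convergent_on UNIV (\<lambda>n t. \<Sum>i<n. D t i)"
    by (rule Weierstrass_m_test'[OF _ M]) (rule bound)
  have "summable (\<lambda>n. Re (cinner (w 0 n) (G (w 0 n))))"
    unfolding w_def evolution_zero by (rule summable_positive_form[OF G u])
  then show "((\<lambda>t. \<Sum>n. Re (cinner (w t n) (G (w t n)))) has_real_derivative (\<Sum>n. D t n)) (at t)"
    by (intro has_field_derivative_series'(2)[OF convex_UNIV deriv unif, of 0]) auto
qed

section \<open>Fisher information of the postselected state\<close>

lemma positive_op_conjugate:
  assumes F: "positive_op F" and M: "positive_op M"
  shows "positive_op (\<lambda>x. F (M (F x)))"
proof -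
  have "bounded_linear F" "bounded_linear M"
    using positive_opD(1)[OF F] positive_opD(1)[OF M] by (simp_all add: bounded_clinear_def)
  then have "bounded_linear (\<lambda>x. F (M (F x)))"
    using bounded_linear_compose by blast
  then show ?thesis
    unfolding positive_op_def bounded_clinear_def positive_op_hermitian[OF F, symmetric]
    using positive_opD(2,3)[OF M]
    by (simp add: bounded_clinear_scaleC[OF positive_opD(1)[OF F]]
        bounded_clinear_scaleC[OF positive_opD(1)[OF M]])
qed

lemma trace_op_scaleR:
  assumes "positive_op M"
  shows "trace_op (M \<circ> (\<lambda>x. r *\<^sub>R R x)) = of_real r * trace_op (M \<circ> R)"
  unfolding trace_op_def
  by (simp add: bounded_clinear_scaleR[OF positive_opD(1)[OF assms]] cinner_scaleR_right
      infsum_cmult_right')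

section \<open>Probabilities as series over the mixture, and the bound for one measurement\<close>

lemma ps_probability_series:
  fixes A :: "'a::chilbert_space \<Rightarrow> 'a"
  assumes A: "hermitian_op A" and mix: "mixture \<rho> u"
    and B: "orthonormal_basis B" "Fps \<subseteq> B"
  shows "ps_probability A \<rho> Fps t =
    (\<Sum>n. Re (cinner (evolution A t (u n)) (ps_projector Fps (evolution A t (u n)))))"
  unfolding ps_probability_def
  by (rule sums_unique)
     (rule trace_op_mixture[OF B(1) mixture_evolved_state[OF A mix] ps_projector_positive[OF B]])

lemma ps_outcome_series:
  fixes A :: "'a::chilbert_space \<Rightarrow> 'a"
  assumes A: "hermitian_op A" and mix: "mixture \<rho> u"
    and B: "orthonormal_basis B" "Fps \<subseteq> B" and M: "positive_op M"
  shows "Re (trace_op (M \<circ> ps_state A \<rho> Fps t)) =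
    (\<Sum>n. Re (cinner (evolution A t (u n))
      (ps_projector Fps (M (ps_projector Fps (evolution A t (u n))))))) / ps_probability A \<rho> Fps t"
proof -
  let ?F = "ps_projector Fps"
  have "mixture (?F \<circ> evolved_state A \<rho> t \<circ> ?F) (\<lambda>n. ?F (evolution A t (u n)))"
    using mixture_map[OF mixture_evolved_state[OF A mix] ps_projector_hermitian[OF B], where K = 1]
      ps_projector_norm_le[OF B] by simp
  then have "(\<lambda>n. Re (cinner (?F (evolution A t (u n))) (M (?F (evolution A t (u n))))))
      sums Re (trace_op (M \<circ> (?F \<circ> evolved_state A \<rho> t \<circ> ?F)))"
    using trace_op_mixture[OF B(1) _ M] by blast
  then show ?thesis
    unfolding ps_state_def[abs_def] trace_op_scaleR[OF M] ps_projector_hermitian[OF B]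
    by (simp add: sums_iff comp_def)
qed

text \<open>Cauchy--Schwarz for the sum of the forms over \<open>n\<close>: add up their values at a
  n - l w n, with l = R/Q the minimizing multiplier, and use that the total is nonnegative.\<close>

lemma sum_form_Cauchy_Schwarz:
  fixes w a :: "nat \<Rightarrow> 'a::complex_inner"
  assumes G: "positive_op G"
    and sw: "summable (\<lambda>n. Re (cinner (w n) (G (w n))))"
    and swa: "summable (\<lambda>n. Re (cinner (w n) (G (a n))))"
    and sa: "summable (\<lambda>n. Re (cinner (a n) (G (a n))))"
    and pos: "0 < (\<Sum>n. Re (cinner (w n) (G (w n))))"
  shows "(\<Sum>n. Re (cinner (w n) (G (a n))))\<^sup>2 / (\<Sum>n. Re (cinner (w n) (G (w n)))) \<le>
    (\<Sum>n. Re (cinner (a n) (G (a n))))"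
proof -
  define Q R T where "Q = (\<Sum>n. Re (cinner (w n) (G (w n))))"
    and "R = (\<Sum>n. Re (cinner (w n) (G (a n))))"
    and "T = (\<Sum>n. Re (cinner (a n) (G (a n))))"
  define l where "l = R / Q"
  have expand: "Re (cinner (a n - l *\<^sub>R w n) (G (a n - l *\<^sub>R w n))) =
      Re (cinner (a n) (G (a n))) - 2 * l * Re (cinner (w n) (G (a n))) +
      l\<^sup>2 * Re (cinner (w n) (G (w n)))" for n
  proof -
    have "Re (cinner (a n) (G (w n))) = Re (cinner (w n) (G (a n)))"
      by (metis cinner_commute cnj.sel(1) positive_op_hermitian[OF G])
    then show ?thesis
      by (simp add: bounded_clinear_diff[OF positive_opD(1)[OF G]]
          bounded_clinear_scaleR[OF positive_opD(1)[OF G]] cinner_simps power2_eq_square algebra_simps)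
  qed
  have "(\<lambda>n. Re (cinner (a n) (G (a n))) - 2 * l * Re (cinner (w n) (G (a n))) +
      l\<^sup>2 * Re (cinner (w n) (G (w n)))) sums (T - 2 * l * R + l\<^sup>2 * Q)"
    unfolding Q_def R_def T_def
    by (intro sums_add sums_diff sums_mult summable_sums sw swa sa)
  then have "0 \<le> T - 2 * l * R + l\<^sup>2 * Q"
    by (rule sums_le[OF _ sums_zero, rotated])
       (simp add: expand[symmetric] positive_opD(3)[OF G])
  also have "\<dots> = T - R\<^sup>2 / Q"
    using pos by (simp add: l_def Q_def[symmetric] power2_eq_square field_simps)
  finally show ?thesis
    by (simp add: Q_def R_def T_def)
qed

lemma summable_norm_diff_square:
  fixes x y :: "nat \<Rightarrow> 'a::complex_inner"
  assumes "summable (\<lambda>n. (norm (x n))\<^sup>2)" "summable (\<lambda>n. (norm (y n))\<^sup>2)"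
  shows "summable (\<lambda>n. (norm (x n - y n))\<^sup>2)"
proof (rule summable_comparison_test')
  show "summable (\<lambda>n. 2 * (norm (x n))\<^sup>2 + 2 * (norm (y n))\<^sup>2)"
    using assms by (intro summable_add summable_mult)
  fix n
  have "(norm (x n - y n))\<^sup>2 \<le> (norm (x n) + norm (y n))\<^sup>2"
    by (intro power_mono norm_triangle_ineq4) simp
  also have "\<dots> \<le> 2 * (norm (x n))\<^sup>2 + 2 * (norm (y n))\<^sup>2"
    using sum_squares_bound[of "norm (x n)" "norm (y n)"] by (simp add: power2_sum)
  finally show "norm ((norm (x n - y n))\<^sup>2) \<le> 2 * (norm (x n))\<^sup>2 + 2 * (norm (y n))\<^sup>2"
    by simp
qed

text \<open>The full series of nonnegative terms sums to the squared norm.\<close>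

lemma povm_sum_le:
  assumes "povm M"
  shows "(\<Sum>k<m. Re (cinner x (M k x))) \<le> (norm x)\<^sup>2"
proof -
  have "(\<lambda>k. Re (cinner x (M k x))) sums Re (cinner x x)"
    using assms bounded_linear.sums[OF bounded_linear_compose[OF bounded_linear_Re
      bounded_bilinear.bounded_linear_right[OF bounded_bilinear_cinner]]]
    unfolding povm_def by blast
  then show ?thesis
    using assms sum_le_suminf[of "\<lambda>k. Re (cinner x (M k x))" "{..<m}"]
    by (simp add: sums_iff norm_square_cinner povm_def positive_op_def)
qed

lemma ps_fisher_information_le:
  fixes A \<rho> :: "'a::chilbert_space \<Rightarrow> 'a"
  assumes A: "hermitian_op A" and mix: "mixture \<rho> u" and u: "(\<Sum>n. (norm (u n))\<^sup>2) \<le> 1"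
    and B: "orthonormal_basis B" "Fps \<subseteq> B"
    and bound: "\<And>x. (norm (A x))\<^sup>2 \<le> N * (norm x)\<^sup>2" and "0 \<le> N"
    and M: "povm M" and pos: "0 < ps_probability A \<rho> Fps \<theta>"
  shows "fisher_information (\<lambda>t k. Re (trace_op (M k \<circ> ps_state A \<rho> Fps t))) \<theta> \<le>
    ereal (4 * N / ps_probability A \<rho> Fps \<theta>)"
proof -
  let ?F = "ps_projector Fps"
  define w where "w t n = evolution A t (u n)" for t n
  define v where "v n = (- \<i>) *\<^sub>C A (w \<theta> n)" for n
  define G where "G k x = ?F (M k (?F x))" for k x
  define form where "form X t = (\<Sum>n. Re (cinner (w t n) (X (w t n))))" for X t
  define form' where "form' X = (\<Sum>n. 2 * Re (cinner (w \<theta> n) (X (v n))))" for X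
  define P P' where "P = form ?F \<theta>" and "P' = form' ?F"
  \<comment> \<open>The logarithmic derivative of P. Subtracting (c / 2) w from the velocity
    accounts for the changing normalization: <w|G k|a> then sums to (Q' - c Q) / 2, which is P / 2
    times the derivative of Q / P.\<close>
  define c where "c = P' / P"
  define a where "a n = v n - (c / 2) *\<^sub>R w \<theta> n" for n
  define T where "T k = (\<Sum>n. Re (cinner (a n) (G k (a n))))" for k
  have F: "positive_op ?F"
    by (rule ps_projector_positive[OF B])
  have Mk: "positive_op (M k)" for k
    using M by (simp add: povm_def)
  have G: "positive_op (G k)" for k
    using positive_op_conjugate[OF F Mk] by (simp add: G_def[abs_def])
  have su: "summable (\<lambda>n. (norm (u n))\<^sup>2)"
    using mix by (simp add: mixture_def)
  have sw: "summable (\<lambda>n. (norm (w t n))\<^sup>2)" for t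
    using su by (simp add: w_def evolution_norm[OF A])
  have v_le: "(norm (v n))\<^sup>2 \<le> N * (norm (u n))\<^sup>2" for n
    using bound[of "w \<theta> n"] by (simp add: v_def norm_scaleC w_def evolution_norm[OF A])
  have sv: "summable (\<lambda>n. (norm (v n))\<^sup>2)"
    by (rule summable_comparison_test'[OF summable_mult[OF su, of N]]) (simp add: v_le)
  have sa: "summable (\<lambda>n. (norm (a n))\<^sup>2)"
    unfolding a_def using sv summable_mult[OF sw[of \<theta>], of "(c / 2)\<^sup>2"]
    by (intro summable_norm_diff_square) (simp_all add: power_mult_distrib power_divide)
  have deriv: "(form X has_real_derivative form' X) (at \<theta>)"
    and s': "summable (\<lambda>n. 2 * Re (cinner (w \<theta> n) (X (v n))))" if "positive_op X" for X
    using mixture_form_has_derivative[OF A that su, of \<theta>]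
    by (simp_all add: form_def[abs_def] form'_def w_def v_def)
  have prob: "ps_probability A \<rho> Fps t = form ?F t" for t
    by (simp add: ps_probability_series[OF A mix B] form_def w_def)
  have outcome: "Re (trace_op (M k \<circ> ps_state A \<rho> Fps t)) = form (G k) t / form ?F t" for k t
    unfolding ps_outcome_series[OF A mix B Mk] prob by (simp add: form_def w_def G_def)
  have "0 < P"
    using pos by (simp add: prob P_def)
  have T0: "0 \<le> T k" for k
    unfolding T_def by (intro suminf_nonneg summable_positive_form[OF G sa] positive_opD(3)[OF G])
  have term_le: "(if form (G k) \<theta> / form ?F \<theta> > 0
      then ereal ((deriv (\<lambda>t. form (G k) t / form ?F t) \<theta>)\<^sup>2 / (form (G k) \<theta> / form ?F \<theta>)) else 0)
      \<le> ereal (4 * T k / P)" (is "?term k \<le> _") for k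
  proof (cases "form (G k) \<theta> / form ?F \<theta> > 0")
    case True
    define Q Q' where "Q = form (G k) \<theta>" and "Q' = form' (G k)"
    have "0 < Q"
      using True \<open>0 < P\<close> by (simp add: Q_def P_def zero_less_divide_iff)
    have "((\<lambda>t. form (G k) t / form ?F t) has_real_derivative (Q' * P - Q * P') / (P * P)) (at \<theta>)"
      unfolding Q_def Q'_def P_def P'_def
      using \<open>0 < P\<close> by (intro DERIV_divide deriv F G) (simp add: P_def)
    then have d: "deriv (\<lambda>t. form (G k) t / form ?F t) \<theta> = (Q' * P - Q * P') / (P * P)"
      by (rule DERIV_imp_deriv)
    have cross: "Re (cinner (w \<theta> n) (G k (a n))) =
        1 / 2 * (2 * Re (cinner (w \<theta> n) (G k (v n)))) - c / 2 * Re (cinner (w \<theta> n) (G k (w \<theta> n)))" for n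
      by (simp add: a_def bounded_clinear_diff[OF positive_opD(1)[OF G]]
          bounded_clinear_scaleR[OF positive_opD(1)[OF G]] cinner_simps)
    have R: "(\<lambda>n. Re (cinner (w \<theta> n) (G k (a n)))) sums (1 / 2 * Q' - c / 2 * Q)"
      unfolding cross Q_def Q'_def form_def form'_def
      by (intro sums_diff sums_mult summable_sums s' G summable_positive_form[OF G sw])
    have "(1 / 2 * Q' - c / 2 * Q)\<^sup>2 / Q \<le> T k"
      using sum_form_Cauchy_Schwarz[OF G summable_positive_form[OF G sw[of \<theta>]]
          sums_summable[OF R] summable_positive_form[OF G sa]] \<open>0 < Q\<close>
      unfolding sums_unique[OF R, symmetric] by (simp add: Q_def T_def form_def)
    then have "4 * ((1 / 2 * Q' - c / 2 * Q)\<^sup>2 / Q) / P \<le> 4 * T k / P"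
      using \<open>0 < P\<close> by (intro divide_right_mono mult_left_mono) auto
    \<comment> \<open>The left side is the bounded quantity from Cauchy--Schwarz; the right side is
      the Fisher term of the quotient rule.\<close>
    moreover have "4 * ((1 / 2 * Q' - c / 2 * Q)\<^sup>2 / Q) / P = ((Q' * P - Q * P') / (P * P))\<^sup>2 / (Q / P)"
      using \<open>0 < P\<close> \<open>0 < Q\<close> by (simp add: c_def field_simps power2_eq_square)
    ultimately show ?thesis
      using True by (simp add: d Q_def P_def)
  next
    case False
    then show ?thesis
      using T0[of k] \<open>0 < P\<close> by simp
  qed
  have sum_le: "(\<Sum>k<m. 4 * T k / P) \<le> 4 * N / P" for m
  proof -
    have "(\<Sum>k<m. T k) = (\<Sum>n. \<Sum>k<m. Re (cinner (a n) (G k (a n))))"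
      unfolding T_def by (intro suminf_sum[symmetric] summable_positive_form[OF G sa])
    also have "\<dots> \<le> (\<Sum>n. Re (cinner (a n) (?F (a n))))"
    proof (rule suminf_le)
      \<comment> \<open>Apply the completeness bound of the effects to the projected vector; its
        squared norm is <a|F|a>.\<close>
      show "(\<Sum>k<m. Re (cinner (a n) (G k (a n)))) \<le> Re (cinner (a n) (?F (a n)))" for n
        using povm_sum_le[OF M, of "?F (a n)" m]
        by (simp add: G_def ps_projector_norm_square[OF B] ps_projector_hermitian[OF B, symmetric])
    qed (intro summable_sum summable_positive_form[OF G sa] summable_positive_form[OF F sa])+
    also have "\<dots> = (\<Sum>n. Re (cinner (v n) (?F (v n)))) - c / 2 * P' + (c / 2)\<^sup>2 * P"
    proof -
      have "Re (cinner (a n) (?F (a n))) = Re (cinner (v n) (?F (v n))) -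
          c / 2 * (2 * Re (cinner (w \<theta> n) (?F (v n)))) + (c / 2)\<^sup>2 * Re (cinner (w \<theta> n) (?F (w \<theta> n)))" for n
      proof -
        have "Re (cinner (v n) (?F (w \<theta> n))) = Re (cinner (w \<theta> n) (?F (v n)))"
          by (metis cinner_commute cnj.sel(1) positive_op_hermitian[OF F])
        then show ?thesis
          by (simp add: a_def bounded_clinear_diff[OF positive_opD(1)[OF F]]
              bounded_clinear_scaleR[OF positive_opD(1)[OF F]] cinner_simps power2_eq_square algebra_simps)
      qed
      then have "(\<lambda>n. Re (cinner (a n) (?F (a n)))) sums
          ((\<Sum>n. Re (cinner (v n) (?F (v n)))) - c / 2 * P' + (c / 2)\<^sup>2 * P)"
        unfolding P_def P'_def form_def form'_def
        by (simp only:) (intro sums_add sums_diff sums_mult summable_sums s' F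
            summable_positive_form[OF F sv] summable_positive_form[OF F sw])
      then show ?thesis
        by (simp add: sums_iff)
    qed
    \<comment> \<open>With c = P'/P the two correction terms combine to -P'^2 / (4 P), which is at
      most 0.\<close>
    also have "\<dots> \<le> (\<Sum>n. Re (cinner (v n) (?F (v n))))"
      using \<open>0 < P\<close> by (simp add: c_def power2_eq_square divide_simps)
    also have "\<dots> \<le> (\<Sum>n. N * (norm (u n))\<^sup>2)"
    proof (rule suminf_le)
      show "Re (cinner (v n) (?F (v n))) \<le> N * (norm (u n))\<^sup>2" for n
        using order_trans[OF power_mono[OF ps_projector_norm_le[OF B] norm_ge_zero] v_le]
        by (simp add: ps_projector_norm_square[OF B])
    qed (intro summable_positive_form[OF F sv] summable_mult su)+
    also have "\<dots> = N * (\<Sum>n. (norm (u n))\<^sup>2)"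
      by (rule suminf_mult[OF su])
    also have "\<dots> \<le> N * 1"
      using u \<open>0 \<le> N\<close> by (intro mult_left_mono)
    finally have "4 * (\<Sum>k<m. T k) / P \<le> 4 * N / P"
      using \<open>0 < P\<close> by (intro divide_right_mono) auto
    then show ?thesis
      by (simp add: sum_distrib_left sum_divide_distrib)
  qed
  have partial: "(\<Sum>k<m. ?term k) \<le> ereal (4 * N / P)" for m
  proof -
    have "(\<Sum>k<m. ?term k) \<le> (\<Sum>k<m. ereal (4 * T k / P))"
      by (intro sum_mono term_le)
    also have "\<dots> = ereal (\<Sum>k<m. 4 * T k / P)"
      by simp
    also have "\<dots> \<le> ereal (4 * N / P)"
      using sum_le[of m] by simp
    finally show ?thesis .
  qed
  have nonneg: "0 \<le> (if z > 0 then ereal (d / z) else 0)" if "0 \<le> d" for d z :: real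
    using that by simp
  have "(\<Sum>k. ?term k) \<le> ereal (4 * N / P)"
    by (intro suminf_bound allI partial nonneg zero_le_power2)
  then show ?thesis
    unfolding fisher_information_def outcome prob P_def .
qed

section \<open>Nonnegativity, decomposition of the initial state, and the norm of the squared
  generator\<close>

lemma fisher_information_nonneg: "0 \<le> fisher_information p \<theta>"
  unfolding fisher_information_def by (intro suminf_nonneg summable_ereal_pos) auto

text \<open>The trivial measurement, with the identity as its only nonzero effect, shows that the
  supremum is not over an empty set, where it would be minus infinity.\<close>

lemma quantum_fisher_information_nonneg:
  fixes \<sigma> :: "real \<Rightarrow> 'a::complex_inner \<Rightarrow> 'a"
  shows "0 \<le> quantum_fisher_information \<sigma> \<theta>"
proof -
  define M :: "nat \<Rightarrow> 'a \<Rightarrow> 'a" where "M k x = (if k = 0 then x else 0)" for k x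
  have "positive_op (M k)" for k
    using positive_op_id
    by (cases "k = 0") (simp_all add: M_def[abs_def] positive_op_def bounded_clinear_def
        module.scale_zero_right[OF complex_inner_module])
  moreover have "(\<lambda>k. M k x) sums x" for x
    unfolding M_def using sums_single[of 0 "\<lambda>_. x"] by simp
  ultimately have "povm M"
    by (simp add: povm_def)
  then show ?thesis
    unfolding quantum_fisher_information_def
    by (intro SUP_upper2[of M]) (simp_all add: fisher_information_nonneg)
qed

lemma density_op_mixture:
  fixes \<rho> :: "'a::complex_inner \<Rightarrow> 'a"
  assumes \<rho>: "density_op \<rho>" and B: "orthonormal_basis (B :: 'a set)"
  obtains u where "mixture \<rho> u" "(\<Sum>n. (norm (u n))\<^sup>2) \<le> 1"
proof -
  define E :: "'a set" where "E = (SOME E. orthonormal_basis E)"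
  have E: "orthonormal_basis E"
    unfolding E_def using B by (rule someI)
  have trace: "(\<Sum>\<^sub>\<infinity>b\<in>E. cinner b (\<rho> b)) = 1"
    using \<rho> by (simp add: density_op_def trace_op_def E_def)
  \<comment> \<open>A divergent sum would have the default value 0 instead of 1.\<close>
  then have "(\<lambda>b. cinner b (\<rho> b)) summable_on E"
    using infsum_not_exists by fastforce
  then have "((\<lambda>b. cinner b (\<rho> b)) has_sum 1) E"
    using trace has_sum_infsum by metis
  then have "((\<lambda>b. Re (cinner b (\<rho> b))) has_sum Re 1) E"
    by (rule has_sum_Re)
  then show ?thesis
    using positive_trace_class_mixture[OF _ E] \<rho> that by (auto simp: density_op_def)
qed

text \<open>Symmetry gives <x|A^2|x> = |A x|^2, so the supremum bounds |A x|^2 on unit vectors, and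
  scaling extends this to all vectors. The unit vector \<open>e\<close> supplies nonnegativity of
  the supremum; boundedness of \<open>A\<close> makes it a genuine one.\<close>

lemma op_norm_square:
  fixes A :: "'a::complex_inner \<Rightarrow> 'a"
  assumes A: "hermitian_op A" and e: "cinner (e::'a) e = 1"
  shows "(norm (A x))\<^sup>2 \<le> op_norm (A \<circ> A) * (norm x)\<^sup>2" "0 \<le> op_norm (A \<circ> A)"
proof -
  have eq: "Re (cinner x ((A \<circ> A) x)) = (norm (A x))\<^sup>2" for x
    by (simp add: norm_square_cinner hermitian_opD(2)[OF A])
  obtain K where K: "\<And>x. norm (A x) \<le> norm x * K"
    using hermitian_opD(1)[OF A] bounded_linear.bounded unfolding bounded_clinear_def by blast
  have "bdd_above ((\<lambda>x. Re (cinner x ((A \<circ> A) x))) ` {x. cinner x x = 1})"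
  proof (rule bdd_aboveI2)
    fix x :: 'a
    assume "x \<in> {x. cinner x x = 1}"
    then have "norm x = 1"
      by (simp add: norm_eq_sqrt_cinner)
    then show "Re (cinner x ((A \<circ> A) x)) \<le> K\<^sup>2"
      unfolding eq using power_mono[OF K[of x], of 2] by simp
  qed
  then have upper: "(norm (A x))\<^sup>2 \<le> op_norm (A \<circ> A)" if "cinner x x = 1" for x
    unfolding op_norm_def eq[symmetric] using that by (intro cSUP_upper) auto
  show "0 \<le> op_norm (A \<circ> A)"
    using upper[OF e] zero_le_power2 order_trans by blast
  show "(norm (A x))\<^sup>2 \<le> op_norm (A \<circ> A) * (norm x)\<^sup>2"
  proof (cases "x = 0")
    case True
    then show ?thesis
      using K[of 0] by simp
  next
    case False
    define y where "y = (1 / norm x) *\<^sub>R x"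
    have "cinner y y = 1"
      using False by (simp add: y_def cinner_self)
    then have "(norm (A y))\<^sup>2 \<le> op_norm (A \<circ> A)"
      by (rule upper)
    moreover have "norm (A y) = norm (A x) / norm x"
      by (simp add: y_def bounded_clinear_scaleR[OF hermitian_opD(1)[OF A]] divide_inverse mult.commute)
    ultimately show ?thesis
      using False by (simp add: power_divide divide_le_eq)
  qed
qed

theorem theorem2:
  fixes A \<rho>\<^sub>0 :: "'a::chilbert_space \<Rightarrow> 'a"
    and B Fps :: "'a set"
    and \<theta> :: real
  assumes "density_op \<rho>\<^sub>0"
    and "hermitian_op A"
    and "orthonormal_basis B"
    and "Fps \<subseteq> B"
  shows "0 \<le> ps_efficiency (ps_probability A \<rho>\<^sub>0 Fps \<theta>) (ps_qfi A \<rho>\<^sub>0 Fps \<theta>) \<and>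
    ps_efficiency (ps_probability A \<rho>\<^sub>0 Fps \<theta>) (ps_qfi A \<rho>\<^sub>0 Fps \<theta>) \<le> ereal (4 * op_norm (A \<circ> A))"
proof -
  note A = assms(2) and B = assms(3,4)
  define P where "P = ps_probability A \<rho>\<^sub>0 Fps \<theta>"
  define N where "N = op_norm (A \<circ> A)"
  obtain u where u: "mixture \<rho>\<^sub>0 u" "(\<Sum>n. (norm (u n))\<^sup>2) \<le> 1"
    using density_op_mixture[OF assms(1,3)] .
  \<comment> \<open>An empty basis would force every vector to be 0 and hence the trace to be 0,
    against trace 1. A basis element then serves as the unit vector for
    \<open>op_norm_square\<close>.\<close>
  have "B \<noteq> {}"
  proof
    assume "B = {}"
    then have "((\<lambda>b. cinner b x *\<^sub>C b) has_sum x) {}" for x :: 'a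
      using orthonormal_expansion[OF B(1)] by simp
    then have "x = 0" for x :: 'a
      using has_sum_empty has_sum_unique by blast
    then have "trace_op \<rho>\<^sub>0 = 0"
      unfolding trace_op_def by (metis cinner_zero_left infsum_0)
    then show False
      using assms(1) by (simp add: density_op_def)
  qed
  then obtain e where "e \<in> B"
    by blast
  then have e: "cinner e e = 1"
    using orthonormal_basisD[OF B(1)] by simp
  note N = op_norm_square[OF A e, folded N_def]
  have "0 \<le> P"
    unfolding P_def ps_probability_series[OF A u(1) B]
  proof (intro suminf_nonneg summable_positive_form[OF ps_projector_positive[OF B]])
    show "summable (\<lambda>n. (norm (evolution A \<theta> (u n)))\<^sup>2)"
      using u(1) by (simp add: mixture_def evolution_norm[OF A])
  qed (rule positive_opD(3)[OF ps_projector_positive[OF B]])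
  have "0 \<le> ps_qfi A \<rho>\<^sub>0 Fps \<theta>"
    unfolding ps_qfi_def by (rule quantum_fisher_information_nonneg)
  then have "0 \<le> ps_efficiency P (ps_qfi A \<rho>\<^sub>0 Fps \<theta>)"
    using \<open>0 \<le> P\<close> by (simp add: ps_efficiency_def)
  moreover have "ps_efficiency P (ps_qfi A \<rho>\<^sub>0 Fps \<theta>) \<le> ereal (4 * N)"
  \<comment> \<open>At probability 0 the efficiency is 0 whatever the Fisher information, as 0 times
    infinity is 0 in the extended reals. Otherwise P cancels against the bound 4 N / P.\<close>
  proof (cases "P = 0")
    case True
    then show ?thesis
      using N(2) by (simp add: ps_efficiency_def zero_ereal_def[symmetric])
  next
    case False
    then have "0 < P"
      using \<open>0 \<le> P\<close> by simp
    have "ps_qfi A \<rho>\<^sub>0 Fps \<theta> \<le> ereal (4 * N / P)"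
      unfolding ps_qfi_def quantum_fisher_information_def
      using ps_fisher_information_le[OF A u B N] \<open>0 < P\<close>
      by (intro SUP_least) (simp add: P_def)
    then have "ereal P * ps_qfi A \<rho>\<^sub>0 Fps \<theta> \<le> ereal P * ereal (4 * N / P)"
      using \<open>0 \<le> P\<close> by (intro ereal_mult_left_mono) auto
    also have "\<dots> = ereal (4 * N)"
      using False by simp
    finally show ?thesis
      by (simp add: ps_efficiency_def)
  qed
  ultimately show ?thesis
    by (simp add: P_def N_def)
qed

end
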